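(* Let $p$ be an odd prime number, $q=p^s$, $r=p^t$, with integers $s,t\ge 1$, and let $l\ge 1$ be an integer. Let $(a,\epsilon_1,\epsilon_2)\in(\mathbb F_q^* )^3$ be given, and let $$P_a(T)=(T^2+a)^{(r-1)/2},\qquad Q_a(T)=a^{-1}\bigl(TP_a(T)-T^r\bigr)$$ in $\mathbb F_q[T]$. Let $\alpha=[a_1,a_2,\dots,a_n,\dots]\in\mathbb F(q)$ be the infinite continued fraction defined by $$(a_1,\dots,a_l)=(\lambda_1T+\mu_1,\dots,\lambda_lT+\mu_l),\quad (\lambda_i,\mu_i)\in\mathbb F_q^*\times\mathbb F_q\ \text{ for } 1\le i\le l,$$ and $$\alpha^r=\epsilon_1P_a\,\alpha_{l+1}+\epsilon_2Q_a .$$ Assume that the $(2l+1)$-tuple $(\lambda_1,\dots,\lambda_l,\mu_1,\dots,\mu_{l-1},a,\epsilon_2)$ is such that, for $1\le i\le l$, we can define the pair $(\delta_i,\nu_i)\in\mathbb F_q^*\times\mathbb F_q$ in the following way (i.e. all denominators below are nonzero and all $\delta_i$, $1\le i\le l$, are nonzero): $$(C_1)\qquad \delta_1=a\lambda_1^r+\epsilon_2,\quad \nu_1=0,\quad\text{and for }1\le i\le l-1$$ $$\delta_{i+1}=a\lambda_{i+1}^r-\frac{\delta_i}{a^{r-2}\delta_i^2+(\nu_i-\mu_i^r)^2},\qquad \nu_{i+1}=\frac{\nu_i-\mu_i^r}{a^{r-2}\delta_i^2+(\nu_i-\mu_i^r)^2}.$$ Assume also that the pair $(\epsilon_1,\mu_l)$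 is such that $$(C_2)\quad \delta_l=-a(\epsilon_1/\epsilon_2)^r\qquad\text{and}\qquad (C_3)\quad \mu_l^r=\nu_l .$$ Then all partial quotients $a_n$ ($n\ge1$) of $\alpha$ have degree $1$ (that is, $\alpha\in\mathcal E^*(r,l,a,q)$). Moreover, writing $a_n=\lambda_nT+\mu_n$ for $n\ge 1$, the sequence of partial quotients is described as follows. For $n\in\mathbb N^*$ set $f(n)=nr+l+1-r$ and $g(n)=nr+l+(1-r)/2$. Define the following subsets of $\mathbb N^*$: $I=\{i : 1\le i\le l\}$, $I^*=\{i\in I : \nu_i-\mu_i^r\ne 0\}$, $F=\{f^m(i) : m\ge 1,\ i\in I\}$, $G=\{g^m(i) : m\ge 1,\ i\in I^*\}$ (the sets $I^*$ and $G$ may be empty), where $f^m,g^m$ denote $m$-fold iterates. Write $F+1=\{n+1:n\in F\}$ and $G+1=\{n+1:n\in G\}$. For $n>l+1$ define $C(n)$ by $C(n)=4a^{-1}$ if $n\notin F\cup(F+1)\cup(G+1)$, and $$C(n)=2a^{-1}\bigl(1-a^{-1}\lambda_i^{-r}\delta_i\bigr)^{-r^{m-1}}\quad\text{if } n=f^m(i),\ m\ge1,\ i\in I\ (n\ne f(1)),$$ $$C(n)=2a^{-1}\bigl(a\lambda_i^r\delta_i^{-1}\bigr)^{r^{m-1}}\quad\text{if } n=f^m(i)+1,\ m\ge1,\ i\in I,$$ $$C(n)=4a^{-1}\bigl(1+a^{2-r}(\nu_i-\mu_i^r)^2\delta_i^{-2}\bigr)^{-r^{m-1}}\quad\text{if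 } n=g^m(i)+1,\ m\ge1,\ i\in I^*.$$ Then the sequence $(\lambda_n)_{n\ge1}$ in $\mathbb F_q^*$ is given recursively, for $n\ge l+1$, by $$\lambda_{l+1}=\lambda_1^r\epsilon_1^{-1}\quad\text{and}\quad \lambda_n=C(n)\lambda_{n-1}^{-1}\ \text{ for } n>l+1 .$$ The sequence $(\mu_n)_{n\ge1}$ in $\mathbb F_q$ is given, for $n\ge l+1$, as follows: if $n\notin G\cup(G+1)$, then $\mu_n=0$; if $n=g^m(i)$ with $m\ge1$ and $i\in I^*$, then $$\mu_n\lambda_n^{-1}=-\mu_{n+1}\lambda_{n+1}^{-1}=\tfrac12\,(-a)^{(r^{m-1}(2-r)+1)/2}\,\bigl((\nu_i-\mu_i^r)\delta_i^{-1}\bigr)^{r^{m-1}} .$$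
   Context: $\mathbb F_q$ is the finite field with $q$ elements; $\mathbb F(q)=\mathbb F_q((1/T))$ is the field of formal power series in $1/T$ over $\mathbb F_q$, with the ultrametric absolute value extending $|P/Q|=|T|^{\deg P-\deg Q}$, where $|T|>1$ is a fixed real number. Every irrational element $\alpha\in\mathbb F(q)$ (i.e. not in $\mathbb F_q(T)$) has a unique infinite continued fraction expansion $\alpha=[a_1,a_2,\dots,a_n,\dots]=a_1+1/(a_2+1/(\cdots))$ with partial quotients $a_i\in\mathbb F_q[T]$, $\deg a_i>0$ for $i>1$; the complete quotient is $\alpha_i=[a_i,a_{i+1},\dots]\in\mathbb F(q)$. Known existence fact used in the definition of $\alpha$: given $l\ge1$, polynomials $a_1,\dots,a_l\in\mathbb F_q[T]$ with $\deg a_i\ge1$, and $(P,Q)\in(\mathbb F_q[T])^2$ with $\deg Q<\deg P<r$, there is a unique infinite continued fraction $\alpha\in\mathbb F(q)$ with $\alpha=[a_1,\dots,a_l,\alpha_{l+1}]$ and $\alpha^r=P\alpha_{l+1}+Q$. Here $\deg P_a=r-1>\deg Q_a=r-2$, so $\alpha$ is well defined. $\mathcal E(r,l,a,q)$ denotes the set of infinite continued fractions $\alpha\in\mathbb F(q)$ defined by $\alpha=[a_1,\dots,a_l,\alpha_{l+1}]$ and $\alpha^r=\epsilon_1P_a\alpha_{l+1}+\epsilon_2Q_a$, where $a_i=\lambda_iT+\mu_i$ with $\lambda_i\in\mathbb F_q^*$, $\mu_i\in\mathbb F_q$ for $1\le i\le l$ and $(\epsilon_1,\epsilon_2)\in(\mathbb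 F_q^* )^2$. $\mathcal E^*(r,l,a,q)$ is the subset of those $\alpha$ all of whose partial quotients have degree $1$. $\mathbb N^*$ is the set of positive integers. *)

theory Defs
  imports "HOL-Computational_Algebra.Computational_Algebra" "HOL-Library.Cardinality"
begin

(* F_q((1/T)) is the type 'a fls over a finite field 'a, the variable fls_X of the
   library standing for 1/T, so that T is fls_X_inv.  The library metric on 'a fls is the one
   of the ultrametric absolute value normalised by |T| = 2; any other |T| > 1 gives the
   same topology. *)

definition poly_to_fls :: "'a::field poly \<Rightarrow> 'a fls" where
  "poly_to_fls P = poly (map_poly fls_const P) fls_X_inv"

fun fin_cfrac :: "'a::field list \<Rightarrow> 'a" where
  "fin_cfrac [] = 0"
| "fin_cfrac [x] = x"
| "fin_cfrac (x # y # xs) = x + 1 / fin_cfrac (y # xs)"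

text \<open>Partial quotients are indexed from 1; the value \<open>A 0\<close> is irrelevant.
  \<open>cfrac_segment A i n\<close> is \<open>[A i, \<dots>, A (i + n)]\<close>.\<close>

definition cfrac_segment :: "(nat \<Rightarrow> 'a::field poly) \<Rightarrow> nat \<Rightarrow> nat \<Rightarrow> 'a fls" where
  "cfrac_segment A i n = fin_cfrac (map (\<lambda>k. poly_to_fls (A k)) [i..<Suc (i + n)])"

definition has_cfrac :: "'a::field fls \<Rightarrow> (nat \<Rightarrow> 'a poly) \<Rightarrow> bool" where
  "has_cfrac \<alpha> A \<longleftrightarrow> (\<forall>i>1. degree (A i) > 0) \<and> cfrac_segment A 1 \<longlonglongrightarrow> \<alpha>"

definition complete_quotient :: "(nat \<Rightarrow> 'a::field poly) \<Rightarrow> nat \<Rightarrow> 'a fls" where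
  "complete_quotient A i = lim (cfrac_segment A i)"

definition P_poly :: "nat \<Rightarrow> 'a::field \<Rightarrow> 'a poly" where
  "P_poly r a = [:a, 0, 1:] ^ ((r - 1) div 2)"

definition Q_poly :: "nat \<Rightarrow> 'a::field \<Rightarrow> 'a poly" where
  "Q_poly r a = smult (inverse a) ([:0, 1:] * P_poly r a - [:0, 1:] ^ r)"

definition E_set :: "nat \<Rightarrow> nat \<Rightarrow> 'a::field \<Rightarrow> 'a fls set" where
  "E_set r l a = {\<alpha>. \<exists>A lam mu \<epsilon>1 \<epsilon>2.
     has_cfrac \<alpha> A \<and> \<epsilon>1 \<noteq> 0 \<and> \<epsilon>2 \<noteq> 0 \<and>
     (\<forall>i\<in>{1..l}. lam i \<noteq> 0 \<and> A i = [:mu i, lam i:]) \<and>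
     \<alpha> ^ r = fls_const \<epsilon>1 * poly_to_fls (P_poly r a) * complete_quotient A (l + 1)
            + fls_const \<epsilon>2 * poly_to_fls (Q_poly r a)}"

definition E_star :: "nat \<Rightarrow> nat \<Rightarrow> 'a::field \<Rightarrow> 'a fls set" where
  "E_star r l a = {\<alpha> \<in> E_set r l a. \<exists>A. has_cfrac \<alpha> A \<and> (\<forall>n\<ge>1. degree (A n) = 1)}"

text \<open>For \<open>n \<ge> 1\<close> and odd \<open>r\<close> the truncated subtraction and division below are exact.\<close>

definition f_map :: "nat \<Rightarrow> nat \<Rightarrow> nat \<Rightarrow> nat" where
  "f_map r l n = n * r + l + 1 - r"

definition g_map :: "nat \<Rightarrow> nat \<Rightarrow> nat \<Rightarrow> nat" where
  "g_map r l n = n * r + l - (r - 1) div 2"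

definition I_star :: "nat \<Rightarrow> nat \<Rightarrow> (nat \<Rightarrow> 'a::field) \<Rightarrow> (nat \<Rightarrow> 'a) \<Rightarrow> nat set" where
  "I_star r l mu \<nu> = {i \<in> {1..l}. \<nu> i - mu i ^ r \<noteq> 0}"

definition F_set :: "nat \<Rightarrow> nat \<Rightarrow> nat set" where
  "F_set r l = {(f_map r l ^^ m) i | m i. m \<ge> 1 \<and> i \<in> {1..l}}"

definition G_set :: "nat \<Rightarrow> nat \<Rightarrow> (nat \<Rightarrow> 'a::field) \<Rightarrow> (nat \<Rightarrow> 'a) \<Rightarrow> nat set" where
  "G_set r l mu \<nu> = {(g_map r l ^^ m) i | m i. m \<ge> 1 \<and> i \<in> I_star r l mu \<nu>}"

text \<open>The case distinction defining \<open>C(n)\<close> for \<open>n > l + 1\<close>, as a property of a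
  function \<open>C\<close>. The excluded case \<open>n = f(1)\<close> is \<open>n = l + 1\<close>.\<close>

definition is_C :: "nat \<Rightarrow> nat \<Rightarrow> 'a::field \<Rightarrow> (nat \<Rightarrow> 'a) \<Rightarrow> (nat \<Rightarrow> 'a) \<Rightarrow>
    (nat \<Rightarrow> 'a) \<Rightarrow> (nat \<Rightarrow> 'a) \<Rightarrow> (nat \<Rightarrow> 'a) \<Rightarrow> bool" where
  "is_C r l a lam mu \<delta> \<nu> C \<longleftrightarrow> (\<forall>n>l + 1.
     (n \<notin> F_set r l \<union> Suc ` F_set r l \<union> Suc ` G_set r l mu \<nu> \<longrightarrow>
        C n = 4 * inverse a) \<and>
     (\<forall>m\<ge>1. \<forall>i\<in>{1..l}. n = (f_map r l ^^ m) i \<longrightarrow>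
        C n = 2 * inverse a *
          (1 - inverse a * lam i powi (- int r) * \<delta> i) powi (- int (r ^ (m - 1)))) \<and>
     (\<forall>m\<ge>1. \<forall>i\<in>{1..l}. n = (f_map r l ^^ m) i + 1 \<longrightarrow>
        C n = 2 * inverse a * (a * lam i ^ r * inverse (\<delta> i)) ^ (r ^ (m - 1))) \<and>
     (\<forall>m\<ge>1. \<forall>i\<in>I_star r l mu \<nu>. n = (g_map r l ^^ m) i + 1 \<longrightarrow>
        C n = 4 * inverse a *
          (1 + a powi (2 - int r) * (\<nu> i - mu i ^ r)\<^sup>2 * \<delta> i powi (-2))
            powi (- int (r ^ (m - 1)))))"

end

theory Submission
  imports Defs
begin

text \<open>
  Write \<open>r = 2k + 1\<close> and let \<open>U\<^sub>n\<close> be the Lucas sequence \<open>U\<^sub>n\<^sub>+\<^sub>2 = T U\<^sub>n\<^sub>+\<^sub>1 + (a/4) U\<^sub>n\<close>.  In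
  characteristic \<open>p\<close> one has \<open>P\<^sub>a = U\<^sub>r\<close> and \<open>Q\<^sub>a = - U\<^sub>r\<^sub>-\<^sub>1 / 2\<close>, so \<open>P\<^sub>a / (\<delta> Q\<^sub>a)\<close> expands into \<open>2k\<close>
  partial quotients proportional to \<open>T\<close>.  By the Cassini identity, adding a constant to \<open>\<delta> Q\<^sub>a\<close> only
  perturbs the two middle ones.

  Each \<open>n\<close> satisfies a relation
  \<open>\<alpha>\<^sub>n\<^sup>r = \<epsilon> P\<^sub>a \<alpha>\<^bsub>f(n)\<^esub> + (\<delta>\<^sub>n - a \<lambda>\<^sub>n\<^sup>r) Q\<^sub>a + \<nu>\<^sub>n\<close>.
  Since \<open>\<alpha>\<^sub>n\<^sup>r = \<lambda>\<^sub>n\<^sup>r T\<^sup>r + \<mu>\<^sub>n\<^sup>r + 1 / \<alpha>\<^sub>n\<^sub>+\<^sub>1\<^sup>r\<close> and \<open>T\<^sup>r = T P\<^sub>a - a Q\<^sub>a\<close>, it yields the \<open>r\<close> partial quotients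
  with indices from \<open>f(n)\<close> to \<open>f(n + 1) - 1\<close> together with the relation for \<open>n + 1\<close>, where \<open>\<delta>\<close> and \<open>\<nu>\<close>
  follow the recursion of \<open>(C\<^sub>1)\<close>.  The process never breaks down because \<open>w\<^sub>n = a \<lambda>\<^sub>n\<^sup>r / \<delta>\<^sub>n\<close> and
  \<open>z\<^sub>n = (\<nu>\<^sub>n - \<mu>\<^sub>n\<^sup>r) / \<delta>\<^sub>n\<close> reproduce themselves beyond \<open>l\<close>: \<open>w\<^bsub>f(n)\<^esub> = w\<^sub>n\<^sup>r\<close> and \<open>w = 2\<close> at all other
  indices, \<open>z\<^bsub>g(n)\<^esub>\<close> is a constant times \<open>z\<^sub>n\<^sup>r\<close> and \<open>z = 0\<close> at all other indices.  The conditions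
  \<open>(C\<^sub>2)\<close> and \<open>(C\<^sub>3)\<close> start this pattern at \<open>l + 1 = f(1)\<close>.
\<close>

section \<open>Lucas sequences in odd characteristic\<close>

fun lucas_U :: "'a::comm_ring_1 \<Rightarrow> 'a \<Rightarrow> nat \<Rightarrow> 'a" where
  "lucas_U t b 0 = 0"
| "lucas_U t b (Suc 0) = 1"
| "lucas_U t b (Suc (Suc n)) = t * lucas_U t b (Suc n) + b * lucas_U t b n"

text \<open>Binet's formula multiplied by \<open>u - v\<close>, so that it is an identity in every
  commutative ring.\<close>

lemma lucas_U_binet:
  "(u - v) * lucas_U (u + v) (- (u * v)) n = u ^ n - v ^ n"
proof (induction n rule: induct_nat_012)
  case (ge2 n)
  have "(u - v) * lucas_U (u + v) (- (u * v)) (Suc (Suc n))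
      = (u + v) * ((u - v) * lucas_U (u + v) (- (u * v)) (Suc n))
        - (u * v) * ((u - v) * lucas_U (u + v) (- (u * v)) n)"
    by (simp add: algebra_simps)
  also have "\<dots> = u ^ Suc (Suc n) - v ^ Suc (Suc n)"
    unfolding ge2 by (simp add: algebra_simps)
  finally show ?case .
qed auto

text \<open>The right-hand side is the companion Lucas sequence of power sums, which Frobenius
  evaluates at exponent \<open>r\<close>; here it is expressed through the first sequence.\<close>

lemma lucas_U_trace:
  "lucas_U (u + v) (- (u * v)) (Suc (Suc n)) - u * v * lucas_U (u + v) (- (u * v)) n
    = u ^ Suc n + v ^ Suc n"
proof (induction n rule: induct_nat_012)
  case (ge2 n)
  let ?U = "lucas_U (u + v) (- (u * v))"
  have "?U (Suc (Suc (Suc (Suc n)))) - u * v * ?U (Suc (Suc n))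
      = (u + v) * (?U (Suc (Suc (Suc n))) - u * v * ?U (Suc n))
        - u * v * (?U (Suc (Suc n)) - u * v * ?U n)"
    by (simp add: algebra_simps)
  also have "\<dots> = u ^ Suc (Suc (Suc n)) + v ^ Suc (Suc (Suc n))"
    unfolding ge2 by (simp add: algebra_simps)
  finally show ?case .
qed (auto simp: algebra_simps)

lemma poly_lucas_U: "poly (lucas_U t b n) x = lucas_U (poly t x) (poly b x) n"
  by (induction t b n rule: lucas_U.induct) auto

lemma pcompose_lucas_U:
  "pcompose (lucas_U t b n) q = lucas_U (pcompose t q) (pcompose b q) n"
  by (induction t b n rule: lucas_U.induct)
     (auto simp: pcompose_1 pcompose_add pcompose_mult)

text \<open>A solution depends linearly on its first two values, with Lucas terms as coefficients.
  This solves in closed form every stretch on which the coefficients are constant, wherever the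
  stretch starts.\<close>

lemma lucas_U_recurrence:
  assumes "\<And>i. i < n \<Longrightarrow> y (i + 2) = t * y (i + 1) + b * y i"
  shows "y (n + 1) = lucas_U t b (n + 1) * y 1 + b * lucas_U t b n * y 0"
  using assms
proof (induction n rule: induct_nat_012)
  case (ge2 n)
  have "y (Suc (Suc n) + 1) = t * y (Suc n + 1) + b * y (n + 1)"
    using ge2.prems[of "Suc n"] by (simp add: numeral_2_eq_2)
  also have "y (Suc n + 1) = lucas_U t b (Suc n + 1) * y 1 + b * lucas_U t b (Suc n) * y 0"
    using ge2.prems by (intro ge2.IH(2)) auto
  also have "y (n + 1) = lucas_U t b (n + 1) * y 1 + b * lucas_U t b n * y 0"
    using ge2.prems by (intro ge2.IH(1)) auto
  finally show ?case by (simp add: algebra_simps)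
qed (auto simp: numeral_2_eq_2 dest: spec[of _ 0])

lemma lucas_U_add:
  "lucas_U t b (m + n + 1) =
    lucas_U t b (m + 1) * lucas_U t b (n + 1) + b * lucas_U t b m * lucas_U t b n"
  using lucas_U_recurrence[of n "\<lambda>i. lucas_U t b (m + i)" t b]
  by (simp add: numeral_2_eq_2 algebra_simps)

text \<open>Each step multiplies this determinant by \<open>- b\<close>, the determinant of the
  companion matrix.\<close>

lemma lucas_U_Cassini:
  "lucas_U t b (n + 2) * lucas_U t b n - (lucas_U t b (n + 1))\<^sup>2 = - ((- b) ^ n)"
proof (induction n)
  case (Suc n)
  have "lucas_U t b (Suc n + 2) * lucas_U t b (Suc n) - (lucas_U t b (Suc n + 1))\<^sup>2
     = (- b) * (lucas_U t b (n + 2) * lucas_U t b n - (lucas_U t b (n + 1))\<^sup>2)"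
    by (simp add: numeral_2_eq_2 power2_eq_square algebra_simps)
  then show ?case unfolding Suc.IH by simp
qed auto

lemma power_r_add:
  fixes x y :: "'a::comm_ring_1"
  assumes "CHAR('a) = p" "prime p" "r = p ^ e"
  shows "(x + y) ^ r = x ^ r + y ^ r"
  using freshmans_dream'[where x = x and y = y and m = r and n = e] assms by simp

text \<open>
  With \<open>u, v = (T \<plusminus> X) / 2\<close> the Frobenius map turns \<open>u\<^sup>r - v\<^sup>r\<close> into \<open>X\<^sup>r\<close> and \<open>u\<^sup>r + v\<^sup>r\<close> into \<open>T\<^sup>r\<close>.
  Both sides are polynomials in \<open>X\<^sup>2\<close>, for which \<open>T\<^sup>2 + a\<close> may be substituted; this avoids adjoining a
  square root.
\<close>

lemma lucas_U_char:
  fixes T a :: "'k::field"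
  assumes char: "CHAR('k) = p" "prime p" and r: "r = p ^ e" "r = 2 * k + 1" and two: "(2::'k) \<noteq> 0"
  shows "lucas_U T (a / 4) r = (T\<^sup>2 + a) ^ k"
    and "lucas_U T (a / 4) (r + 1) + a / 4 * lucas_U T (a / 4) (r - 1) = T ^ r"
proof -
  define u v where "u = [:T / 2, 1 / 2:]" and "v = [:T / 2, - 1 / 2:]"
  \<comment> \<open>Read in the variable \<open>X\<^sup>2\<close>, \<open>B\<close> is
    \<open>- (u * v)\<close>; its value at \<open>T\<^sup>2 + a\<close> is the parameter
    \<open>a / 4\<close>.\<close>
  define B where "B = [:- T\<^sup>2 / 4, 1 / 4:]"
  have four: "(4::'k) \<noteq> 0"
    using two by (metis mult_2 mult_eq_0_iff numeral_Bit0)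
  have uv: "u + v = [:T:]" "u - v = [:0, 1:]" "- (u * v) = pcompose B [:0, 0, 1:]"
    using two four by (auto simp: u_def v_def B_def pcompose_pCons field_simps power2_eq_square)
  have uv': "u * v = - pcompose B [:0, 0, 1:]"
    using uv(3) by (metis minus_minus)
  have dream: "(x + y :: 'k poly) ^ r = x ^ r + y ^ r" for x y
    using char r by (intro power_r_add) auto
  have dream_diff: "u ^ r - v ^ r = (u - v) ^ r"
    using dream[of "u - v" v] by simp
  have BT: "poly B (T\<^sup>2 + a) = a / 4"
    using four by (simp add: B_def field_simps)
  \<comment> \<open>\<open>U n\<close> is a polynomial in the variable \<open>X\<^sup>2\<close>:
    composition with \<open>X\<^sup>2\<close> leads to Binet's formula, evaluation at
    \<open>T\<^sup>2 + a\<close> to the claim.\<close>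
  define U where "U = lucas_U [:T:] B"
  have comp: "pcompose (U n) [:0, 0, 1:] = lucas_U (u + v) (- (u * v)) n" for n
    by (simp add: U_def pcompose_lucas_U uv)
  have U: "poly (U n) (T\<^sup>2 + a) = lucas_U T (a / 4) n" for n
    by (simp add: U_def poly_lucas_U BT)
  have X2: "pcompose ([:0, 1:] ^ n) [:0, 0, 1:] = ([:0, 1:] ^ (2 * n) :: 'k poly)" for n
  proof (induction n)
    case (Suc n)
    then show ?case by (simp add: pcompose_mult pcompose_pCons)
  qed (simp add: pcompose_1)
  \<comment> \<open>Identities proved after composition with \<open>X\<^sup>2\<close> descend to
    \<open>U\<close> because this composition is injective.\<close>
  have X2_inj: "h = 0" if "pcompose (h :: 'k poly) [:0, 0, 1:] = 0" for h
    using pcompose_eq_0[OF that] by simp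
  have "[:0, 1:] * pcompose (U r) [:0, 0, 1:] = ([:0, 1:] :: 'k poly) ^ r"
    using lucas_U_binet[of u v r] unfolding comp dream_diff uv by simp
  also have "\<dots> = [:0, 1:] * pcompose ([:0, 1:] ^ k) [:0, 0, 1:]"
    using r(2) by (simp add: X2)
  finally have "pcompose (U r) [:0, 0, 1:] = pcompose ([:0, 1:] ^ k) [:0, 0, 1:]"
    by (metis mult_cancel_left one_neq_zero pCons_eq_0_iff)
  then have "pcompose (U r - [:0, 1:] ^ k) [:0, 0, 1:] = 0"
    by (simp only: pcompose_diff) simp
  then have "U r - [:0, 1:] ^ k = 0" by (rule X2_inj)
  then have "poly (U r) (T\<^sup>2 + a) = poly ([:0, 1:] ^ k) (T\<^sup>2 + a)"
    by simp
  then show "lucas_U T (a / 4) r = (T\<^sup>2 + a) ^ k"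
    by (simp add: U poly_power)
  obtain r' where r': "r = Suc r'" using r(2) by (cases r) auto
  have "pcompose (U (r + 1) + B * U (r - 1) - [:T:] ^ r) [:0, 0, 1:]
     = u ^ r + v ^ r - (u + v) ^ r"
    using lucas_U_trace[of u v r']
    by (simp add: pcompose_diff pcompose_add pcompose_mult comp r' uv uv' poly_const_pow del: power_Suc)
  then have "pcompose (U (r + 1) + B * U (r - 1) - [:T:] ^ r) [:0, 0, 1:] = 0"
    by (simp add: dream)
  then have "U (r + 1) + B * U (r - 1) - [:T:] ^ r = 0" by (rule X2_inj)
  then have "poly (U (r + 1) + B * U (r - 1) - [:T:] ^ r) (T\<^sup>2 + a) = 0"
    by simp
  then show "lucas_U T (a / 4) (r + 1) + a / 4 * lucas_U T (a / 4) (r - 1) = T ^ r"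
    by (simp add: U BT poly_power)
qed

section \<open>Continued fractions of formal Laurent series\<close>

lemma of_nat_CARD_eq_0: "of_nat CARD('a) = (0 :: 'a::{comm_ring_1,finite})"
proof -
  \<comment> \<open>Translation by 1 permutes the ring; comparing the sums of all elements before
    and after leaves \<open>CARD('a)\<close> copies of 1 with sum 0.\<close>
  have "bij (\<lambda>x :: 'a. x + 1)"
    by (rule bij_betw_byWitness[where f' = "\<lambda>x. x - 1"]) auto
  then have "(\<Sum>x\<in>(UNIV :: 'a set). x + 1) = (\<Sum>x\<in>UNIV. x)"
    by (rule sum.reindex_bij_betw)
  then show ?thesis by (simp add: sum.distrib)
qed

lemma CHAR_eq_of_CARD:
  assumes "prime p" "CARD('a::{field,finite}) = p ^ s"
  shows "CHAR('a) = p"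
proof -
  have "CHAR('a) dvd p ^ s"
    using of_nat_CARD_eq_0[where 'a = 'a] assms(2)
    by (simp only: of_nat_eq_0_iff_char_dvd)
  moreover have "prime (CHAR('a))"
    by (simp add: prime_CHAR_semidom finite_imp_CHAR_pos)
  ultimately show ?thesis
    using assms(1) prime_dvd_power primes_dvd_imp_eq by blast
qed

section \<open>Embedding of polynomials and the polynomial part of a series\<close>

lemma poly_to_fls_0 [simp]: "poly_to_fls 0 = 0"
  by (simp add: poly_to_fls_def)

lemma poly_to_fls_pCons [simp]:
  "poly_to_fls (pCons c p) = fls_const c + fls_X_inv * poly_to_fls p"
  by (simp add: poly_to_fls_def map_poly_pCons)

lemma poly_to_fls_add: "poly_to_fls (p + q) = poly_to_fls p + poly_to_fls q"
  by (induction p q rule: poly_induct2) (auto simp: algebra_simps simp flip: fls_plus_const)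

lemma poly_to_fls_smult: "poly_to_fls (smult c p) = fls_const c * poly_to_fls p"
  by (induction p) (auto simp: algebra_simps simp flip: fls_const_mult_const)

lemma poly_to_fls_diff: "poly_to_fls (p - q) = poly_to_fls p - poly_to_fls q"
  using poly_to_fls_add[of p "smult (- 1) q"] poly_to_fls_smult[of "- 1" q] by simp

lemma poly_to_fls_mult: "poly_to_fls (p * q) = poly_to_fls p * poly_to_fls q"
  by (induction p) (auto simp: algebra_simps poly_to_fls_add poly_to_fls_smult)

lemma poly_to_fls_1 [simp]: "poly_to_fls 1 = 1"
  unfolding one_pCons by simp

lemma poly_to_fls_power: "poly_to_fls (p ^ n) = poly_to_fls p ^ n"
  by (induction n) (auto simp: poly_to_fls_mult)

lemma fls_X_inv_mult_nth: "fls_nth (fls_X_inv * f) k = fls_nth f (k + 1)"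
  for f :: "'a::field fls"
  by (simp add: fls_X_inv_times_conv_shift)

text \<open>As \<open>fls_X\<close> is 1/T, powers of T occupy the non-positive indices. Hence the
  subdegree is minus the degree, and an absolute value below 1 means positive subdegree.\<close>

lemma poly_to_fls_nth:
  "fls_nth (poly_to_fls p) k = (if k \<le> 0 then coeff p (nat (- k)) else 0)"
proof (induction p arbitrary: k)
  case (pCons c p)
  show ?case
  proof (cases "k = 0")
    case False
    have "fls_nth (poly_to_fls (pCons c p)) k = fls_nth (poly_to_fls p) (k + 1)"
      using False by (simp add: fls_X_inv_mult_nth)
    moreover have "nat (- k) = Suc (nat (- (k + 1)))" if "k < 0"
      using that by simp
    ultimately show ?thesis
      using False by (auto simp: pCons.IH)
  qed (auto simp: fls_X_inv_mult_nth pCons.IH)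
qed auto

lemma poly_to_fls_eq_0_iff [simp]: "poly_to_fls p = 0 \<longleftrightarrow> p = 0"
proof
  assume "poly_to_fls p = 0"
  then have "coeff p n = 0" for n
    using poly_to_fls_nth[of p "- int n"] by simp
  then show "p = 0" by (simp add: poly_eq_iff)
qed simp

lemma fls_subdegree_poly_to_fls: "fls_subdegree (poly_to_fls p) = - int (degree p)"
proof (cases "p = 0")
  case False
  show ?thesis
    by (rule fls_subdegree_eqI) (use False in \<open>auto simp: poly_to_fls_nth coeff_eq_0\<close>)
qed simp

text \<open>Polynomials occupy indices up to 0 and the remainders only positive ones, so no
  coefficients mix. The zero remainder is listed apart, here and below, because
  \<open>fls_subdegree 0 = 0\<close>.\<close>

lemma polynomial_part_unique:
  assumes "poly_to_fls p + v = poly_to_fls q + w"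
    and "v = 0 \<or> 0 < fls_subdegree v" and "w = 0 \<or> 0 < fls_subdegree w"
  shows "p = q" "v = w"
proof -
  have "coeff p n = coeff q n" for n
  proof -
    have "fls_nth v (- int n) = 0" "fls_nth w (- int n) = 0"
      using assms(2,3) by auto
    then show ?thesis
      using arg_cong[OF assms(1), of "\<lambda>f. fls_nth f (- int n)"] by (simp add: poly_to_fls_nth)
  qed
  then show "p = q" by (simp add: poly_eq_iff)
  then show "v = w" using assms(1) by simp
qed

section \<open>Convergence of continued fractions and complete quotients\<close>

lemma cfrac_segment_0: "cfrac_segment A i 0 = poly_to_fls (A i)"
  by (simp add: cfrac_segment_def)

lemma cfrac_segment_Suc:
  "cfrac_segment A i (Suc n) = poly_to_fls (A i) + inverse (cfrac_segment A (Suc i) n)"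
proof -
  have "[i..<Suc (i + Suc n)] = i # Suc i # [Suc (Suc i)..<Suc (Suc i + n)]"
    by (simp add: upt_rec)
  moreover have "[Suc i..<Suc (Suc i + n)] = Suc i # [Suc (Suc i)..<Suc (Suc i + n)]"
    by (simp add: upt_rec)
  ultimately show ?thesis
    unfolding cfrac_segment_def by (simp add: inverse_eq_divide)
qed

text \<open>The inverse of the tail has positive subdegree and cannot disturb the leading term of
  the first partial quotient.\<close>

lemma cfrac_segment_subdegree:
  assumes "\<And>j. j \<ge> i \<Longrightarrow> 0 < degree (A j)"
  shows "cfrac_segment A i n \<noteq> 0 \<and> fls_subdegree (cfrac_segment A i n) = - int (degree (A i))"
  using assms
proof (induction n arbitrary: i)
  case 0
  then have "A i \<noteq> 0" by (metis degree_0 less_irrefl order_refl)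
  then show ?case by (simp add: cfrac_segment_0 fls_subdegree_poly_to_fls)
next
  case (Suc n)
  let ?t = "cfrac_segment A (Suc i) n"
  have t: "?t \<noteq> 0" "fls_subdegree ?t = - int (degree (A (Suc i)))"
    using Suc.IH[of "Suc i"] Suc.prems by auto
  have deg: "0 < degree (A i)" "0 < degree (A (Suc i))" using Suc.prems by auto
  then have nz: "poly_to_fls (A i) \<noteq> 0" by auto
  have "fls_subdegree (poly_to_fls (A i)) < fls_subdegree (inverse ?t)"
    using deg t by (simp add: fls_subdegree_poly_to_fls)
  then have "fls_subdegree (cfrac_segment A i (Suc n)) = - int (degree (A i))"
    unfolding cfrac_segment_Suc using nz fls_subdegree_add_eq1[OF nz]
    by (simp add: fls_subdegree_poly_to_fls)
  \<comment> \<open>Zero would have subdegree 0, but the subdegree found is negative.\<close>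
  then show ?case using deg by (metis fls_zero_subdegree neg_equal_0_iff_equal of_nat_0_eq_iff less_irrefl)
qed

lemma fls_dist_less_iff:
  fixes x y :: "'a::field fls"
  shows "dist x y < inverse (2 ^ n) \<longleftrightarrow> x = y \<or> int n < fls_subdegree (x - y)"
proof (cases "x = y \<or> fls_subdegree (x - y) < 0")
  case True
  have "inverse (2 ^ n) \<le> (1::real)" "(1::real) \<le> 2 ^ nat (- fls_subdegree (x - y))"
    by (simp_all add: field_simps)
  then have "\<not> 2 ^ nat (- fls_subdegree (x - y)) < (inverse (2 ^ n) :: real)" by linarith
  then show ?thesis using True by (auto simp: dist_fls_def)
next
  case False
  then show ?thesis by (auto simp: dist_fls_def)
qed

text \<open>The distance is a power of 2 with exponent minus the subdegree of the difference, so
  convergence becomes a statement about subdegrees only.\<close>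

lemma fls_tendsto_iff:
  fixes X :: "nat \<Rightarrow> 'a::field fls"
  shows "X \<longlonglongrightarrow> L \<longleftrightarrow> (\<forall>N. \<forall>\<^sub>F n in sequentially. X n = L \<or> N < fls_subdegree (X n - L))"
proof
  assume *: "X \<longlonglongrightarrow> L"
  show "\<forall>N. \<forall>\<^sub>F n in sequentially. X n = L \<or> N < fls_subdegree (X n - L)"
  proof
    fix N :: int
    have "\<forall>\<^sub>F n in sequentially. dist (X n) L < inverse (2 ^ nat N)"
      using tendstoD[OF *] by simp
    then show "\<forall>\<^sub>F n in sequentially. X n = L \<or> N < fls_subdegree (X n - L)"
      by eventually_elim (auto simp: fls_dist_less_iff split: if_splits)
  qed
next
  assume *: "\<forall>N. \<forall>\<^sub>F n in sequentially. X n = L \<or> N < fls_subdegree (X n - L)"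
  show "X \<longlonglongrightarrow> L"
  proof (rule tendstoI)
    fix e :: real assume "e > 0"
    then obtain N where N: "(1 / 2) ^ N < e"
      using real_arch_pow_inv[of e "1/2"] by auto
    from *[rule_format, of "int N"] show "\<forall>\<^sub>F n in sequentially. dist (X n) L < e"
      by eventually_elim
         (metis N fls_dist_less_iff inverse_eq_divide order_less_trans power_one_over)
  qed
qed

text \<open>The inverted tail segments converge to \<open>L\<close> minus the first partial
  quotient. They share one subdegree, which the limit inherits by the ultrametric inequality; so the
  limit is nonzero and inversion is continuous there. The degree condition starts after
  \<open>i\<close> because the first partial quotient may be constant.\<close>

lemma cfrac_tail:
  fixes A :: "nat \<Rightarrow> 'a::field poly"
  assumes deg: "\<And>j. j > i \<Longrightarrow> 0 < degree (A j)"
    and lim: "cfrac_segment A i \<longlonglongrightarrow> L"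
  obtains M where "cfrac_segment A (Suc i) \<longlonglongrightarrow> M" "M \<noteq> 0"
    "fls_subdegree M = - int (degree (A (Suc i)))" "L = poly_to_fls (A i) + inverse M"
proof
  let ?s = "cfrac_segment A i" and ?t = "cfrac_segment A (Suc i)"
  define d where "d = int (degree (A (Suc i)))"
  define w where "w = L - poly_to_fls (A i)"
  have t: "?t n \<noteq> 0" "fls_subdegree (?t n) = - d" for n
    using cfrac_segment_subdegree[of "Suc i" A n] deg by (auto simp: d_def)
  have ev: "\<forall>\<^sub>F n in sequentially. inverse (?t n) = w \<or> N < fls_subdegree (inverse (?t n) - w)" for N
  proof -
    have "\<forall>\<^sub>F n in sequentially. ?s (Suc n) = L \<or> N < fls_subdegree (?s (Suc n) - L)"
      using lim unfolding fls_tendsto_iff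
      using eventually_sequentially_Suc[of "\<lambda>n. ?s n = L \<or> N < fls_subdegree (?s n - L)"] by blast
    then show ?thesis
      by eventually_elim (auto simp: cfrac_segment_Suc w_def algebra_simps)
  qed
  have w: "w \<noteq> 0 \<and> fls_subdegree w = d"
  proof -
    obtain n where n: "inverse (?t n) = w \<or> d < fls_subdegree (inverse (?t n) - w)"
      using ev[of d] by (auto simp: eventually_sequentially)
    from n show ?thesis
    proof
      assume "inverse (?t n) = w"
      then show ?thesis using t[of n] by auto
    next
      assume *: "d < fls_subdegree (inverse (?t n) - w)"
      have "fls_subdegree (inverse (?t n) - (inverse (?t n) - w)) = fls_subdegree (inverse (?t n))"
        using t[of n] * by (intro fls_subdegree_diff_eq1) auto
      moreover have "inverse (?t n) - w \<noteq> inverse (?t n)"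
        using t[of n] * by auto
      ultimately show ?thesis using t[of n] by auto
    qed
  qed
  show "inverse w \<noteq> 0" using w by simp
  show "fls_subdegree (inverse w) = - int (degree (A (Suc i)))" using w by (simp add: d_def)
  show "L = poly_to_fls (A i) + inverse (inverse w)" by (simp add: w_def)
  show "?t \<longlonglongrightarrow> inverse w"
    unfolding fls_tendsto_iff
  proof
    fix N
    \<comment> \<open>Inverting both terms multiplies their difference by two factors of subdegree
      \<open>- d\<close>; the margin \<open>2 * d\<close> pays for them.\<close>
    from ev[of "N + 2 * d"]
    show "\<forall>\<^sub>F n in sequentially. ?t n = inverse w \<or> N < fls_subdegree (?t n - inverse w)"
    proof eventually_elim
      case (elim n)
      have eq: "?t n - inverse w = - (?t n * inverse w * (inverse (?t n) - w))"
        using t(1)[of n] w by (simp add: field_simps)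
      show ?case
      proof (cases "inverse (?t n) = w")
        case False
        then have "fls_subdegree (?t n - inverse w) = - d - d + fls_subdegree (inverse (?t n) - w)"
          unfolding eq using t[of n] w by simp
        then show ?thesis using elim False by simp
      qed (use t in auto)
    qed
  qed
qed

text \<open>\<open>complete_quotient\<close> is a \<open>lim\<close>, which says something only once
  convergence is known; convergence passes from one index to the next by
  \<open>cfrac_tail\<close>.\<close>

lemma complete_quotient_tendsto:
  assumes "has_cfrac \<alpha> A" "i \<ge> 1"
  shows "cfrac_segment A i \<longlonglongrightarrow> complete_quotient A i"
  using assms(2)
proof (induction i rule: dec_induct)
  case base
  then show ?case
    using assms(1) unfolding has_cfrac_def complete_quotient_def by (auto simp: limI)
next
  case (step i)
  then obtain M where "cfrac_segment A (Suc i) \<longlonglongrightarrow> M"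
    using cfrac_tail[of i A] assms(1) unfolding has_cfrac_def
    by (metis One_nat_def Suc_le_eq le_less_trans less_imp_le_nat not_less)
  then show ?case unfolding complete_quotient_def by (simp add: limI)
qed

lemma complete_quotient_1: "has_cfrac \<alpha> A \<Longrightarrow> complete_quotient A 1 = \<alpha>"
  unfolding has_cfrac_def complete_quotient_def by (auto simp: limI)

lemma complete_quotient_step:
  assumes "has_cfrac \<alpha> A" "i \<ge> 1"
  shows "complete_quotient A i = poly_to_fls (A i) + inverse (complete_quotient A (Suc i))"
    and "complete_quotient A (Suc i) \<noteq> 0"
    and "fls_subdegree (complete_quotient A (Suc i)) < 0"
proof -
  have deg: "\<And>j. j > i \<Longrightarrow> 0 < degree (A j)"
    using assms unfolding has_cfrac_def by auto
  obtain M where M: "cfrac_segment A (Suc i) \<longlonglongrightarrow> M" "M \<noteq> 0"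
    "fls_subdegree M = - int (degree (A (Suc i)))"
    "complete_quotient A i = poly_to_fls (A i) + inverse M"
    using cfrac_tail[OF deg complete_quotient_tendsto[OF assms]] by metis
  have "complete_quotient A (Suc i) = M"
    unfolding complete_quotient_def using M(1) by (rule limI)
  with M deg[of "Suc i"] show
    "complete_quotient A i = poly_to_fls (A i) + inverse (complete_quotient A (Suc i))"
    "complete_quotient A (Suc i) \<noteq> 0"
    "fls_subdegree (complete_quotient A (Suc i)) < 0" by auto
qed

text \<open>The device by which all later partial quotients are read off: it suffices to write a
  complete quotient as a polynomial plus something of absolute value below 1.\<close>

lemma complete_quotient_unique:
  assumes "has_cfrac \<alpha> A" "i \<ge> 1"
    and "complete_quotient A i = poly_to_fls p + w" "w = 0 \<or> 0 < fls_subdegree w"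
  shows "A i = p" "inverse (complete_quotient A (Suc i)) = w"
proof -
  have "poly_to_fls (A i) + inverse (complete_quotient A (Suc i)) = poly_to_fls p + w"
    using complete_quotient_step(1)[OF assms(1,2)] assms(3) by simp
  moreover have "inverse (complete_quotient A (Suc i)) = 0 \<or>
      0 < fls_subdegree (inverse (complete_quotient A (Suc i)))"
    using complete_quotient_step(2,3)[OF assms(1,2)] by simp
  ultimately show "A i = p" "inverse (complete_quotient A (Suc i)) = w"
    using polynomial_part_unique assms(4) by blast+
qed

section \<open>Expansion of three-term recurrences\<close>

fun three_term :: "(nat \<Rightarrow> 'a::comm_ring_1) \<Rightarrow> (nat \<Rightarrow> 'a) \<Rightarrow> 'a \<Rightarrow> 'a \<Rightarrow> nat \<Rightarrow> 'a" where
  "three_term s b v u 0 = v"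
| "three_term s b v u (Suc 0) = u"
| "three_term s b v u (Suc (Suc i)) =
    s i * three_term s b v u (Suc i) + b i * three_term s b v u i"

text \<open>
  The recurrence is run from the end of the expansion, so that all degrees are visible.  The two
  initial values solve the linear system prescribing the last two terms, of determinant \<open>d\<close>.  The
  exceptional coefficients \<open>\<plusminus>m\<close> and \<open>b + m\<^sup>2\<close> are those for which the last term remains \<open>U\<^sub>r\<close> while the
  one before it changes by a constant.
\<close>

lemma three_term_twisted:
  fixes T b m \<zeta> :: "'a::field" and h :: nat
  defines "N \<equiv> (- b) ^ h"
  defines "P \<equiv> lucas_U T b (2 * h + 3)" and "B \<equiv> b * (lucas_U T b (2 * h + 2) + m * N)"
    and "d \<equiv> b * N\<^sup>2 * (b + m\<^sup>2)"
  defines "Y \<equiv> three_term (\<lambda>i. T + (if i = h + 1 then m else if i = h then - m else 0))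
      (\<lambda>i. if i = h + 1 then b + m\<^sup>2 else b) (P * \<zeta> / d) (1 - B * \<zeta> / d)"
  assumes "d \<noteq> 0"
  shows "Y (2 * h + 3) = P" "Y (2 * h + 2) = lucas_U T b (2 * h + 2) - m * N + \<zeta>"
proof -
  define u v where "u = 1 - B * \<zeta> / d" and "v = P * \<zeta> / d"
  define x y where "x = lucas_U T b (h + 1)" and "y = lucas_U T b h"
  have Y01: "Y 0 = v" "Y 1 = u" by (simp_all add: Y_def u_def v_def)
  have Yrec: "Y (i + 2) = (T + (if i = h + 1 then m else if i = h then - m else 0)) * Y (i + 1)
      + (if i = h + 1 then b + m\<^sup>2 else b) * Y i" for i
    by (simp add: Y_def numeral_2_eq_2)
  have U2: "lucas_U T b (h + 2) = T * x + b * y"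
    by (simp add: x_def y_def numeral_2_eq_2)
  have P: "P = (T * x + b * y)\<^sup>2 + b * x\<^sup>2"
    using lucas_U_add[of T b "h + 1" "h + 1"] U2
    by (simp add: P_def x_def y_def power2_eq_square numeral_3_eq_3 numeral_2_eq_2 mult.assoc)
  have U2k: "lucas_U T b (2 * h + 2) = (T * x + b * y) * x + b * x * y"
    using lucas_U_add[of T b "h + 1" h] U2
    by (simp add: x_def y_def numeral_2_eq_2 mult_2 mult.assoc)
  have cassini: "(T * x + b * y) * y - x\<^sup>2 = - N"
    using lucas_U_Cassini[of T b h] unfolding U2 by (simp add: x_def y_def N_def)
  have Z0: "Y (h + 1) = x * u + b * y * v"
  proof -
    have "Y (i + 2) = T * Y (i + 1) + b * Y i" if "i < h" for i
      using that Yrec[of i] by simp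
    then have "Y (h + 1) = lucas_U T b (h + 1) * Y 1 + b * lucas_U T b h * Y 0"
      by (rule lucas_U_recurrence)
    then show ?thesis unfolding Y01 x_def y_def .
  qed
  have Z1: "Y (h + 2) = (T * x + b * y) * u + b * x * v - m * Y (h + 1)"
  proof -
    \<comment> \<open>Moving the exceptional term \<open>- m * Y (h + 1)\<close> to the left
      restores the constant recurrence for one more step.\<close>
    define Y' where "Y' = Y(h + 2 := Y (h + 2) + m * Y (h + 1))"
    have "Y' (i + 2) = T * Y' (i + 1) + b * Y' i" if "i < h + 1" for i
      using that Yrec[of i] by (cases "i = h") (auto simp: Y'_def algebra_simps)
    then have "Y' (h + 1 + 1) = lucas_U T b (h + 1 + 1) * Y' 1 + b * lucas_U T b (h + 1) * Y' 0"
      by (rule lucas_U_recurrence)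
    then have "Y (h + 2) + m * Y (h + 1) = lucas_U T b (h + 2) * u + b * x * v"
      using Y01 by (simp add: Y'_def x_def numeral_2_eq_2)
    then show ?thesis unfolding U2 by (simp add: algebra_simps)
  qed
  have Z2: "Y (h + 3) = (T + m) * Y (h + 2) + (b + m\<^sup>2) * Y (h + 1)"
    using Yrec[of "h + 1"] by (simp add: numeral_3_eq_3 numeral_2_eq_2)
  have tail: "Y (h + 2 + (n + 1)) = lucas_U T b (n + 1) * Y (h + 3) + b * lucas_U T b n * Y (h + 2)" for n
  proof -
    have "Y (h + 2 + (i + 2)) = T * Y (h + 2 + (i + 1)) + b * Y (h + 2 + i)" for i
      using Yrec[of "h + 2 + i"] by (simp add: algebra_simps)
    then show ?thesis
      using lucas_U_recurrence[of n "\<lambda>n. Y (h + 2 + n)" T b] by (simp add: numeral_3_eq_3)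
  qed
  have top: "Y (2 * h + 3) = x * Y (h + 3) + b * y * Y (h + 2)"
    using tail[of h] by (simp add: x_def y_def mult_2 numeral_3_eq_3)
  \<comment> \<open>\<open>x - T * y\<close> stands for \<open>b\<close> times the Lucas term of
    index \<open>h - 1\<close>, in a form that is also right for \<open>h = 0\<close>.\<close>
  have top': "Y (2 * h + 2) = y * Y (h + 3) + (x - T * y) * Y (h + 2)"
  proof (cases h)
    case (Suc h')
    have "x - T * y = b * lucas_U T b h'"
      by (simp add: x_def y_def Suc)
    then show ?thesis
      using tail[of h'] by (simp add: x_def y_def Suc mult_2 numeral_3_eq_3)
  qed (simp add: x_def y_def)
  \<comment> \<open>Modulo the Cassini relation the twist drops out of the coefficient of
    \<open>u\<close>, which is again \<open>P\<close>. Together with \<open>lin2\<close> this is the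
    linear system solved by \<open>u\<close> and \<open>v\<close>.\<close>
  have lin1: "Y (2 * h + 3) = P * u + B * v"
    unfolding top Z2 Z1 Z0 P B_def U2k using cassini by algebra
  have lin2: "Y (2 * h + 2) = (lucas_U T b (2 * h + 2) - m * N) * u + b * (x\<^sup>2 + b * y\<^sup>2) * v"
    unfolding top' Z2 Z1 Z0 U2k using cassini by algebra
  have det: "b * (x\<^sup>2 + b * y\<^sup>2) * P - (lucas_U T b (2 * h + 2) - m * N) * B = d"
    unfolding P B_def U2k d_def using cassini by algebra
  show "Y (2 * h + 3) = P"
    unfolding lin1 u_def v_def by (simp add: algebra_simps)
  have "Y (2 * h + 2) = lucas_U T b (2 * h + 2) - m * N
      + (b * (x\<^sup>2 + b * y\<^sup>2) * P - (lucas_U T b (2 * h + 2) - m * N) * B) * \<zeta> / d"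
    unfolding lin2 u_def v_def by (simp add: algebra_simps add_divide_distrib diff_divide_distrib)
  then show "Y (2 * h + 2) = lucas_U T b (2 * h + 2) - m * N + \<zeta>"
    unfolding det using \<open>d \<noteq> 0\<close> by simp
qed

lemma fls_subdegree_lucas_U:
  fixes b :: "'a::field"
  shows "lucas_U fls_X_inv (fls_const b) (Suc n) \<noteq> 0 \<and>
    fls_subdegree (lucas_U fls_X_inv (fls_const b) (Suc n)) = - int n"
proof (induction n rule: induct_nat_012)
  case (ge2 n)
  let ?U = "lucas_U fls_X_inv (fls_const b)"
  have *: "fls_X_inv * ?U (Suc (Suc n)) \<noteq> 0"
    "fls_subdegree (fls_X_inv * ?U (Suc (Suc n))) = - int (Suc (Suc n))"
    using ge2 by auto
  have "fls_const b * ?U (Suc n) = 0 \<or>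
      fls_subdegree (fls_X_inv * ?U (Suc (Suc n))) < fls_subdegree (fls_const b * ?U (Suc n))"
    using ge2 * by (cases "b = 0") auto
  then have "fls_subdegree (?U (Suc (Suc (Suc n)))) = - int (Suc (Suc n))"
    using * fls_subdegree_add_eq1[OF *(1)] by auto
  then show ?case
    by (metis fls_zero_subdegree neg_equal_0_iff_equal of_nat_eq_0_iff nat.distinct(1))
qed auto

lemma fls_subdegree_lincomb:
  fixes x y :: "'a::field fls"
  assumes "x \<noteq> 0" "y = 0 \<or> fls_subdegree x < fls_subdegree y"
  shows "(fls_X_inv + fls_const m) * x + fls_const b * y \<noteq> 0"
    and "fls_subdegree ((fls_X_inv + fls_const m) * x + fls_const b * y) = fls_subdegree x - 1"
proof -
  have T: "fls_nth (fls_X_inv + fls_const m) (- 1) = 1" by simp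
  have T': "fls_subdegree (fls_X_inv + fls_const m) = - 1"
    by (rule fls_subdegree_eqI) auto
  have nz: "fls_X_inv + fls_const m \<noteq> 0" using T by (metis fls_zero_nth zero_neq_one)
  have *: "(fls_X_inv + fls_const m) * x \<noteq> 0"
    "fls_subdegree ((fls_X_inv + fls_const m) * x) = fls_subdegree x - 1"
    using nz assms(1) T' by auto
  have y: "fls_const b * y = 0 \<or>
      fls_subdegree ((fls_X_inv + fls_const m) * x) < fls_subdegree (fls_const b * y)"
    using assms * by (cases "b = 0 \<or> y = 0") auto
  then show "fls_subdegree ((fls_X_inv + fls_const m) * x + fls_const b * y) = fls_subdegree x - 1"
    using * fls_subdegree_add_eq1[OF *(1)] by auto
  show "(fls_X_inv + fls_const m) * x + fls_const b * y \<noteq> 0"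
  proof
    assume "(fls_X_inv + fls_const m) * x + fls_const b * y = 0"
    then have "fls_const b * y = - ((fls_X_inv + fls_const m) * x)"
      by (metis add.inverse_inverse add_eq_0_iff)
    then show False using y * by auto
  qed
qed

text \<open>Dividing the recurrence by \<open>X (j + 1)\<close> splits
  \<open>X j / X (j + 1)\<close> into a monic linear polynomial and a small remainder. With a scalar
  \<sigma> in front, inverting the remainder gives the next ratio with scalar
  \<open>inverse (\<sigma> * b)\<close>; the scalars become the leading coefficients.\<close>

lemma cfrac_chain:
  fixes A :: "nat \<Rightarrow> 'a::field poly"
  assumes cf: "has_cfrac \<alpha> A"
    and rec: "\<And>j. j < N \<Longrightarrow>
      X j = (fls_X_inv + fls_const (m (j + 1))) * X (j + 1) + fls_const (b (j + 1)) * X (j + 2)"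
    and b: "\<And>j. j < N \<Longrightarrow> b (j + 1) \<noteq> 0"
    and deg: "\<And>j. j < N \<Longrightarrow> X (j + 1) \<noteq> 0 \<and> (X (j + 2) = 0 \<or> fls_subdegree (X (j + 1)) < fls_subdegree (X (j + 2)))"
    and start: "complete_quotient A (i + 1) = fls_const s * X 0 / X 1" "s \<noteq> 0"
  obtains \<sigma> where "\<sigma> 0 = s" "\<And>n. n \<le> N \<Longrightarrow> \<sigma> n \<noteq> 0"
    "\<And>n. n < N \<Longrightarrow> \<sigma> (n + 1) * \<sigma> n * b (n + 1) = 1"
    "\<And>n. n < N \<Longrightarrow> A (i + n + 1) = [:\<sigma> n * m (n + 1), \<sigma> n:]"
    "complete_quotient A (i + N + 1) = fls_const (\<sigma> N) * X N / X (N + 1)"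
proof
  define \<sigma> where "\<sigma> = rec_nat s (\<lambda>n x. inverse (x * b (n + 1)))"
  show \<sigma>0: "\<sigma> 0 = s" by (simp add: \<sigma>_def)
  have \<sigma>_Suc: "\<sigma> (n + 1) = inverse (\<sigma> n * b (n + 1))" for n by (simp add: \<sigma>_def)
  show \<sigma>: "\<sigma> n \<noteq> 0" if "n \<le> N" for n
    using that
  proof (induction n)
    case (Suc n)
    then show ?case using \<sigma>_Suc[of n] b[of n] by simp
  qed (use \<sigma>0 start in simp)
  show "\<sigma> (n + 1) * \<sigma> n * b (n + 1) = 1" if "n < N" for n
    using \<sigma>[of n] b[of n] that unfolding \<sigma>_Suc by (simp add: field_simps)
  have step: "A (i + n + 1) = [:\<sigma> n * m (n + 1), \<sigma> n:] \<and>
      complete_quotient A (i + n + 2) = fls_const (\<sigma> (n + 1)) * X (n + 1) / X (n + 2)"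
    if n: "n < N" and IH: "complete_quotient A (i + n + 1) = fls_const (\<sigma> n) * X n / X (n + 1)" for n
  proof -
    define w where "w = fls_const (\<sigma> n * b (n + 1)) * X (n + 2) / X (n + 1)"
    have nz: "X (n + 1) \<noteq> 0" using deg n by blast
    have small: "w = 0 \<or> 0 < fls_subdegree w"
    proof (cases "X (n + 2) = 0")
      case False
      moreover have "\<sigma> n * b (n + 1) \<noteq> 0" using \<sigma>[of n] b[OF n] n by simp
      ultimately have "fls_const (\<sigma> n * b (n + 1)) * X (n + 2) \<noteq> 0"
        "fls_subdegree (fls_const (\<sigma> n * b (n + 1)) * X (n + 2)) = fls_subdegree (X (n + 2))"
        by (auto simp del: fls_const_mult_const)
      then show ?thesis using deg[OF n] False by (simp add: w_def fls_divide_subdegree)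
    qed (simp add: w_def)
    have expand: "complete_quotient A (i + n + 1) = poly_to_fls [:\<sigma> n * m (n + 1), \<sigma> n:] + w"
    proof -
      have "poly_to_fls [:\<sigma> n * m (n + 1), \<sigma> n:]
          = fls_const (\<sigma> n) * (fls_X_inv + fls_const (m (n + 1)))"
        by (simp add: algebra_simps)
      moreover have "fls_const (\<sigma> n * b (n + 1)) = fls_const (\<sigma> n) * fls_const (b (n + 1))"
        by simp
      ultimately show ?thesis
        unfolding IH rec[OF n] w_def using nz
        by (simp add: add_divide_distrib distrib_left mult.assoc del: fls_const_mult_const)
    qed
    have "1 \<le> i + n + 1" by simp
    note next_quotient = complete_quotient_unique[OF cf this expand small]
    have "inverse w = fls_const (\<sigma> (n + 1)) * X (n + 1) / X (n + 2)"
      unfolding w_def \<sigma>_Suc by (simp add: divide_inverse fls_inverse_const mult_ac)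
    then have "complete_quotient A (i + n + 2) = fls_const (\<sigma> (n + 1)) * X (n + 1) / X (n + 2)"
      using next_quotient(2) by (metis add_2_eq_Suc' inverse_inverse_eq Suc_eq_plus1 add_Suc_right)
    then show ?thesis using next_quotient(1) by simp
  qed
  have cq: "complete_quotient A (i + n + 1) = fls_const (\<sigma> n) * X n / X (n + 1)" if "n \<le> N" for n
    using that
  proof (induction n)
    case (Suc n)
    then show ?case using step[of n] by (simp add: numeral_2_eq_2)
  qed (use start \<sigma>0 in simp)
  then show "complete_quotient A (i + N + 1) = fls_const (\<sigma> N) * X N / X (N + 1)" by simp
  show "A (i + n + 1) = [:\<sigma> n * m (n + 1), \<sigma> n:]" if "n < N" for n
    using step[OF that] cq[of n] that by simp
qed

section \<open>Expansion of one block of \<open>r\<close> partial quotients\<close>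

lemma two_powers_char:
  assumes "CHAR('k::field) = p" "prime p" "r = p ^ e" "r = 2 * k + 1" "(2::'k) \<noteq> 0"
  shows "(2::'k) ^ r = 2" "(4::'k) ^ k = 1"
proof -
  show two: "(2::'k) ^ r = 2"
    using power_r_add[OF assms(1-3), of 1 1] by simp
  have "2 * (4::'k) ^ k = 2 ^ r"
    using assms(4) by (simp add: power_mult)
  then show "(4::'k) ^ k = 1" using two assms(5) by simp
qed

text \<open>The two Frobenius identities give \<open>T ^ r\<close> as \<open>T * U r\<close> plus
  \<open>a / 2\<close> times \<open>U (r - 1)\<close>, and \<open>a\<close> times Q_a is
  \<open>T * U r - T ^ r\<close>.\<close>

lemma poly_to_fls_P_Q:
  fixes a :: "'a::field"
  assumes char: "CHAR('a) = p" "prime p" "r = p ^ e" "r = 2 * k + 1" "(2::'a) \<noteq> 0" and "a \<noteq> 0"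
  shows "poly_to_fls (P_poly r a) = lucas_U fls_X_inv (fls_const (a / 4)) r"
    and "poly_to_fls (Q_poly r a) = - fls_const (1 / 2) * lucas_U fls_X_inv (fls_const (a / 4)) (r - 1)"
    and "fls_X_inv ^ r = fls_X_inv * poly_to_fls (P_poly r a) - fls_const a * poly_to_fls (Q_poly r a)"
proof -
  let ?U = "lucas_U fls_X_inv (fls_const (a / 4))"
  have char': "CHAR('a fls) = p" "(2 :: 'a fls) \<noteq> 0"
    using char fls_const_numeral[where 'a = 'a, of "num.Bit0 num.One"] fls_const_eq_0_iff by (simp, metis)
  have four: "(4::'a) \<noteq> 0"
    using char(5) by (metis mult_2 mult_eq_0_iff numeral_Bit0)
  have a4: "fls_const a / 4 = fls_const (a / 4)"
    using fls_const_divide_const[of a 4] by simp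
  note U = lucas_U_char[OF char'(1) char(2-4) char'(2), of fls_X_inv "fls_const a", unfolded a4]
  have k: "(r - 1) div 2 = k" using char(4) by simp
  show P: "poly_to_fls (P_poly r a) = ?U r"
    unfolding U(1) P_poly_def k poly_to_fls_power by (simp add: power2_eq_square add.commute)
  obtain r' where r': "r = Suc r'" using char(4) by (cases r) auto
  have "fls_const a * poly_to_fls (Q_poly r a) = fls_X_inv * ?U r - fls_X_inv ^ r"
    using \<open>a \<noteq> 0\<close> unfolding Q_poly_def poly_to_fls_smult poly_to_fls_diff poly_to_fls_mult poly_to_fls_power P
    by (simp add: mult.assoc[symmetric])
  also have "\<dots> = - 2 * fls_const (a / 4) * ?U (r - 1)"
    unfolding U(2)[symmetric] unfolding r' by simp
  also have "\<dots> = fls_const a * (- fls_const (1 / 2) * ?U (r - 1))"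
  proof -
    have "fls_const a * fls_const (1 / 2) = 2 * fls_const (a / 4)"
    proof -
      have "a / 4 = a / 2 / 2" by simp
      then have "a * (1 / 2) = 2 * (a / 4)" using char(5) four by simp
      then show ?thesis unfolding fls_const_numeral[symmetric] fls_const_mult_const by (rule arg_cong)
    qed
    then show ?thesis by (simp add: mult.assoc[symmetric])
  qed
  finally have Q: "fls_const a * poly_to_fls (Q_poly r a) = fls_const a * (- fls_const (1 / 2) * ?U (r - 1))" .
  then show "poly_to_fls (Q_poly r a) = - fls_const (1 / 2) * ?U (r - 1)"
    using \<open>a \<noteq> 0\<close> by (simp only: mult_cancel_left fls_const_eq_0_iff) simp
  show "fls_X_inv ^ r = fls_X_inv * poly_to_fls (P_poly r a) - fls_const a * poly_to_fls (Q_poly r a)"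
    unfolding P \<open>fls_const a * _ = fls_X_inv * ?U r - _\<close> by simp
qed

lemma three_term_subdegree:
  fixes u v :: "'a::field fls" and m b :: "nat \<Rightarrow> 'a"
  assumes "u \<noteq> 0" "v = 0 \<or> fls_subdegree u < fls_subdegree v"
  defines "Y \<equiv> three_term (\<lambda>i. fls_X_inv + fls_const (m i)) (\<lambda>i. fls_const (b i)) v u"
  shows "Y (Suc i) \<noteq> 0 \<and> fls_subdegree (Y (Suc i)) = fls_subdegree u - int i \<and>
    (Y i = 0 \<or> fls_subdegree (Y (Suc i)) < fls_subdegree (Y i))"
proof (induction i)
  case (Suc i)
  then show ?case
    using fls_subdegree_lincomb[of "Y (Suc i)" "Y i" "m i" "b i"] by (auto simp: Y_def)
qed (use assms in auto)

text \<open>The given relation makes the complete quotient at \<open>F\<close> a linear polynomial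
  plus a multiple of \<open>Y (2 * h + 2) / P\<close>, where \<open>Y\<close> is a twisted
  three-term sequence ending in \<open>P\<close>. The contribution of the next complete quotient
  enters only through the two initial values of \<open>Y\<close>; their ratio, met at the end of the
  block, returns the new relation.\<close>

lemma cfrac_block:
  fixes a :: "'a::field"
  assumes char: "CHAR('a) = p" "prime p" "r = p ^ e" "r = 2 * k + 1" "(2::'a) \<noteq> 0"
    and k: "k \<ge> 1" and cf: "has_cfrac \<alpha> A" and idx: "n \<ge> 1" "F \<ge> 1"
    and An: "A n = [:\<mu>, lm:]"
    and rel: "complete_quotient A n ^ r =
      fls_const \<epsilon> * poly_to_fls (P_poly r a) * complete_quotient A F
      + fls_const (\<delta> - a * lm ^ r) * poly_to_fls (Q_poly r a) + fls_const \<nu>"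
    and nz: "a \<noteq> 0" "\<epsilon> \<noteq> 0" "lm \<noteq> 0" "\<delta> \<noteq> 0"
    and c: "c = \<nu> - \<mu> ^ r" and D: "D = a ^ (r - 2) * \<delta>\<^sup>2 + c\<^sup>2" "D \<noteq> 0"
    and m: "m = c / (2 * \<delta> * (- a) ^ (k - 1))"
  obtains \<sigma> where "A F = [:0, lm ^ r / \<epsilon>:]" "\<sigma> 0 = 2 * \<epsilon> / \<delta>"
    "\<And>n. n < 2 * k \<Longrightarrow> \<sigma> n \<noteq> 0"
    "\<And>n. n + 1 < 2 * k \<Longrightarrow> \<sigma> (n + 1) * \<sigma> n * (if n + 1 = k then a / 4 + m\<^sup>2 else a / 4) = 1"
    "\<And>n. n < 2 * k \<Longrightarrow>
      A (F + n + 1) = [:\<sigma> n * (if n + 1 = k then m else if n = k then - m else 0), \<sigma> n:]"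
    "complete_quotient A (n + 1) ^ r =
      fls_const (\<delta> * \<sigma> (2 * k - 1) / (2 * D)) * poly_to_fls (P_poly r a) * complete_quotient A (F + r)
      + fls_const (- (\<delta> / D)) * poly_to_fls (Q_poly r a) + fls_const (c / D)"
proof -
  obtain h where h: "k = h + 1" using k by (metis add.commute le_Suc_ex)
  define b where "b = a / 4"
  define N where "N = (- b) ^ h"
  define d where "d = b * N\<^sup>2 * (b + m\<^sup>2)"
  define P Q where "P = poly_to_fls (P_poly r a)" and "Q = poly_to_fls (Q_poly r a)"
  define Z where "Z = inverse (complete_quotient A (n + 1) ^ r)"
  define \<zeta> where "\<zeta> = fls_const (2 / \<delta>) * Z"
  define V where "V = lucas_U fls_X_inv (fls_const b) (2 * h + 2)"
  define B where "B = fls_const b * (V + fls_const (m * N))"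
  have four: "(4::'a) \<noteq> 0"
    using char(5) by (metis mult_2 mult_eq_0_iff numeral_Bit0)
  have r3: "r = 2 * h + 3" using h char(4) by simp
  have PV: "P = lucas_U fls_X_inv (fls_const b) (2 * h + 3)" "Q = - fls_const (1 / 2) * V"
    "fls_X_inv ^ r = fls_X_inv * P - fls_const a * Q"
    using poly_to_fls_P_Q[OF char nz(1)] by (auto simp: P_def Q_def V_def b_def r3)
  \<comment> \<open>Since \<open>4 ^ k = 1\<close> with \<open>k = h + 1\<close>, dividing by
    \<open>4 ^ h\<close> amounts to multiplying by 4.\<close>
  have four_pow: "4 * (4::'a) ^ h = 1"
    using two_powers_char(2)[OF char] h by simp
  have N: "N = 4 * (- a) ^ h"
  proof -
    have "N * 4 ^ h = (- a) ^ h"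
      unfolding N_def b_def power_mult_distrib[symmetric] using four by simp
    then have "N * (4 * 4 ^ h) = 4 * (- a) ^ h" by (simp add: mult_ac)
    then show ?thesis unfolding four_pow by simp
  qed
  \<comment> \<open>This fixes \<open>m\<close>: the twist shifts \<open>Y (2 * h + 2)\<close> by
    \<open>- m * N\<close>, and after scaling by \<open>\<delta> / 2\<close> the shift has to be
    \<open>- c\<close>.\<close>
  have mN: "m * N = 2 * c / \<delta>"
    using nz char(5) unfolding m N h by (simp add: field_simps)
  have bN: "b * N\<^sup>2 = 4 * a ^ (r - 2)"
  proof -
    have "(- a) ^ h * (- a) ^ h = a ^ (2 * h)"
      by (metis mult_2 power2_eq_square power_add power_even_eq power_minus_even power_mult even_two_times_div_two dvd_triv_left)
    then have "N\<^sup>2 = 16 * a ^ (2 * h)" unfolding N power2_eq_square by (simp add: algebra_simps)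
    then show ?thesis using four by (simp add: b_def r3 field_simps)
  qed
  \<comment> \<open>The determinant of the twisted system is the denominator \<open>D\<close> up to
    nonzero factors, so \<open>D \<noteq> 0\<close> also keeps \<open>b + m\<^sup>2\<close>
    nonzero.\<close>
  have d: "d = a * D / \<delta>\<^sup>2"
  proof -
    have "d = b * (b * N\<^sup>2 + (m * N)\<^sup>2)"
      unfolding d_def by (simp add: algebra_simps power2_eq_square)
    also have "\<dots> = (b * 4) * (a ^ (r - 2) + c\<^sup>2 / \<delta>\<^sup>2)"
      unfolding bN mN by (simp add: power_divide power_mult_distrib distrib_left)
    also have "\<dots> = a * D / \<delta>\<^sup>2"
      unfolding D(1) b_def using four nz by (simp add: field_simps)
    finally show ?thesis .
  qed
  have dnz: "d \<noteq> 0" using d D nz by simp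
  then have bm: "b + m\<^sup>2 \<noteq> 0" "b \<noteq> 0" "N \<noteq> 0" by (auto simp: d_def)
  define u v where "u = 1 - B * \<zeta> / fls_const d" and "v = P * \<zeta> / fls_const d"
  define mm bb where "mm = (\<lambda>i. if i = h + 1 then m else if i = h then - m else 0)"
    and "bb = (\<lambda>i. if i = h + 1 then b + m\<^sup>2 else b)"
  define Y where "Y = three_term (\<lambda>i. fls_X_inv + fls_const (mm i)) (\<lambda>i. fls_const (bb i)) v u"
  have hom: "fls_const x * fls_const y = fls_const (x * y)" "fls_const x + fls_const y = fls_const (x + y)"
    "fls_const x ^ i = fls_const (x ^ i)" for x y :: 'a and i
    by (simp_all add: fls_plus_const fls_const_power)
  have Y: "Y (2 * h + 3) = P" "Y (2 * h + 2) = V - fls_const (2 * c / \<delta>) + \<zeta>"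
  proof -
    have d': "fls_const b * ((- fls_const b) ^ h)\<^sup>2 * (fls_const b + (fls_const m)\<^sup>2) = fls_const d"
      by (simp add: d_def N_def fls_plus_const flip: fls_const_power fls_const_uminus)
    have N': "fls_const m * (- fls_const b) ^ h = fls_const (m * N)"
      by (simp add: N_def flip: fls_const_power fls_const_uminus)
    have mm': "fls_X_inv + fls_const (mm i) =
        fls_X_inv + (if i = h + 1 then fls_const m else if i = h then - fls_const m else 0)" for i
      by (simp add: mm_def)
    have bb': "fls_const (bb i) = (if i = h + 1 then fls_const b + (fls_const m)\<^sup>2 else fls_const b)" for i
      by (simp add: bb_def fls_plus_const flip: fls_const_power)
    note tw = three_term_twisted[of "fls_const b" h "fls_const m" fls_X_inv \<zeta>,
        unfolded d' N', folded PV(1), folded V_def, folded B_def]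
    show "Y (2 * h + 3) = P" "Y (2 * h + 2) = V - fls_const (2 * c / \<delta>) + \<zeta>"
      unfolding Y_def mm' bb' u_def v_def mN[symmetric] using tw dnz by auto
  qed
  have cq: "complete_quotient A n = fls_const lm * fls_X_inv + fls_const \<mu> + inverse (complete_quotient A (n + 1))"
    "complete_quotient A (n + 1) \<noteq> 0" "fls_subdegree (complete_quotient A (n + 1)) < 0"
    using complete_quotient_step[OF cf idx(1)] by (simp_all add: An algebra_simps)
  \<comment> \<open>\<open>P\<close> and \<open>V\<close> have degrees \<open>r - 1\<close> and
    \<open>r - 2\<close>, so subdegree at least \<open>r\<close> makes \<open>v\<close> small and
    leaves \<open>u\<close> with leading term 1. The degrees of \<open>Y\<close> then grow by one at
    each step.\<close>
  have Z: "Z \<noteq> 0" "int r \<le> fls_subdegree Z"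
  proof -
    show "Z \<noteq> 0" using cq by (simp add: Z_def)
    have "int r * fls_subdegree (complete_quotient A (n + 1)) \<le> int r * (- 1)"
      using cq(3) by (intro mult_left_mono) auto
    then show "int r \<le> fls_subdegree Z" by (simp add: Z_def fls_subdegree_pow)
  qed
  have \<zeta>: "\<zeta> \<noteq> 0" "int r \<le> fls_subdegree \<zeta>"
    using Z nz char(5) by (auto simp: \<zeta>_def)
  have P: "P \<noteq> 0" "fls_subdegree P = - int (2 * h + 2)"
    using fls_subdegree_lucas_U[of b "2 * h + 2"] by (simp_all add: PV(1) numeral_3_eq_3)
  have V: "V \<noteq> 0" "fls_subdegree V = - int (2 * h + 1)"
    using fls_subdegree_lucas_U[of b "2 * h + 1"] by (simp_all add: V_def)
  have v: "v \<noteq> 0" "0 < fls_subdegree v"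
    using P \<zeta> dnz r3 by (auto simp: v_def fls_divide_subdegree)
  have u: "u \<noteq> 0" "fls_subdegree u = 0"
  proof -
    have "fls_subdegree (V + fls_const (m * N)) = - int (2 * h + 1)"
      using V by (cases "m * N = 0") (auto simp: fls_subdegree_add_eq1 simp del: fls_const_mult_const)
    moreover from this have "V + fls_const (m * N) \<noteq> 0" by auto
    ultimately have "B * \<zeta> / fls_const d \<noteq> 0" "0 < fls_subdegree (B * \<zeta> / fls_const d)"
      using bm \<zeta> dnz r3 by (auto simp: B_def fls_divide_subdegree simp del: fls_const_mult_const)
    then have *: "fls_subdegree u = 0" "fls_nth u 0 = 1"
      unfolding u_def by (auto simp: fls_subdegree_diff_eq1)
    then show "u \<noteq> 0" "fls_subdegree u = 0" by auto
  qed
  have Ydeg: "Y (Suc i) \<noteq> 0" "fls_subdegree (Y (Suc i)) = - int i"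
    "Y i = 0 \<or> fls_subdegree (Y (Suc i)) < fls_subdegree (Y i)" for i
    using three_term_subdegree[of u v mm bb i] u v by (auto simp: Y_def)
  \<comment> \<open>Replacing \<open>T ^ r\<close> by \<open>T * P - a * Q\<close> cancels the terms
    in \<open>a * lm ^ r * Q\<close> and leaves \<open>- \<delta> * Q\<close>; this is why the
    relation has \<open>\<delta> - a * lm ^ r\<close> as coefficient.\<close>
  have rel': "fls_const \<epsilon> * P * complete_quotient A F
      = fls_const (lm ^ r) * fls_X_inv * P + fls_const (\<delta> / 2) * Y (2 * h + 2)"
  proof -
    have add: "(x + y :: 'a fls) ^ r = x ^ r + y ^ r" for x y
      using char by (intro power_r_add) auto
    have "complete_quotient A n ^ r = fls_const (lm ^ r) * fls_X_inv ^ r + fls_const (\<mu> ^ r) + Z"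
      unfolding cq(1) add by (simp add: Z_def power_mult_distrib power_inverse fls_const_power)
    then have "fls_const \<epsilon> * P * complete_quotient A F = fls_const (lm ^ r) * (fls_X_inv * P - fls_const a * Q)
       + fls_const (\<mu> ^ r) + Z - fls_const (\<delta> - a * lm ^ r) * Q - fls_const \<nu>"
      using rel unfolding PV(3) P_def[symmetric] Q_def[symmetric] by (simp add: algebra_simps)
    also have "\<dots> = fls_const (lm ^ r) * fls_X_inv * P - fls_const \<delta> * Q - fls_const c + Z"
      unfolding c fls_minus_const[symmetric] hom(1)[symmetric] by (simp add: algebra_simps)
    also have "- fls_const \<delta> * Q = fls_const (\<delta> / 2) * V"
      unfolding PV(2) by (simp add: mult.assoc[symmetric])
    then have "fls_const (lm ^ r) * fls_X_inv * P - fls_const \<delta> * Q - fls_const c + Z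
        = fls_const (lm ^ r) * fls_X_inv * P + fls_const (\<delta> / 2) * V - fls_const c + Z"
      by simp
    also have "fls_const (\<delta> / 2) * V - fls_const c + Z = fls_const (\<delta> / 2) * Y (2 * h + 2)"
    proof -
      have "fls_const (\<delta> / 2) * fls_const (2 * c / \<delta>) = fls_const c"
        "fls_const (\<delta> / 2) * \<zeta> = Z"
        using nz char(5) by (simp_all add: \<zeta>_def mult.assoc[symmetric])
      then show ?thesis unfolding Y(2) by (simp add: distrib_left right_diff_distrib del: fls_const_mult_const)
    qed
    then have "fls_const (lm ^ r) * fls_X_inv * P + fls_const (\<delta> / 2) * V - fls_const c + Z
      = fls_const (lm ^ r) * fls_X_inv * P + fls_const (\<delta> / 2) * Y (2 * h + 2)"
      by (simp add: algebra_simps)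
    finally show ?thesis .
  qed
  define w where "w = fls_const (\<delta> / (2 * \<epsilon>)) * Y (2 * h + 2) / P"
  have cqF: "complete_quotient A F = poly_to_fls [:0, lm ^ r / \<epsilon>:] + w"
  proof -
    have "fls_const \<epsilon> * P * (poly_to_fls [:0, lm ^ r / \<epsilon>:] + w)
       = (fls_const \<epsilon> * fls_const (lm ^ r / \<epsilon>)) * fls_X_inv * P
         + (fls_const \<epsilon> * fls_const (\<delta> / (2 * \<epsilon>))) * Y (2 * h + 2)"
      using P unfolding w_def by (simp add: distrib_left mult_ac del: fls_const_mult_const)
    also have "\<dots> = fls_const \<epsilon> * P * complete_quotient A F"
      unfolding rel' hom(1) using nz by (simp add: mult.commute)
    finally show ?thesis using P nz by simp
  qed
  have wsub: "w = 0 \<or> 0 < fls_subdegree w"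
    using Ydeg[of "2 * h + 1"] P nz char(5) by (auto simp: w_def fls_divide_subdegree)
  note AF = complete_quotient_unique[OF cf idx(2) cqF wsub]
  have cqF1: "complete_quotient A (F + 1) = fls_const (2 * \<epsilon> / \<delta>) * Y (2 * h + 3) / Y (2 * h + 2)"
  proof -
    have "complete_quotient A (F + 1) = inverse w"
      using AF(2) by (metis Suc_eq_plus1 inverse_inverse_eq)
    moreover have "fls_const (2 * \<epsilon> / \<delta>) = inverse (fls_const (\<delta> / (2 * \<epsilon>)))"
      by (simp add: fls_inverse_const)
    ultimately show ?thesis
      unfolding w_def Y(1) by (simp only: divide_inverse inverse_mult_distrib inverse_inverse_eq mult_ac)
  qed
  have len: "2 * k = 2 * h + 2" using h by simp
  \<comment> \<open>The expansion runs through \<open>Y\<close> from its last term down, so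
    coefficient \<open>2 * k - (n + 1)\<close> of \<open>Y\<close> belongs to partial quotient
    \<open>F + n + 1\<close>.\<close>
  obtain \<sigma> where \<sigma>: "\<sigma> 0 = 2 * \<epsilon> / \<delta>" "\<And>n. n \<le> 2 * k \<Longrightarrow> \<sigma> n \<noteq> 0"
    "\<And>n. n < 2 * k \<Longrightarrow> \<sigma> (n + 1) * \<sigma> n * bb (2 * k - (n + 1)) = 1"
    "\<And>n. n < 2 * k \<Longrightarrow> A (F + n + 1) = [:\<sigma> n * mm (2 * k - (n + 1)), \<sigma> n:]"
    "complete_quotient A (F + 2 * k + 1) = fls_const (\<sigma> (2 * k)) * Y 1 / Y 0"
  proof (rule cfrac_chain[OF cf, of "2 * k" "\<lambda>j. Y (2 * h + 3 - j)" "\<lambda>j. mm (2 * k - j)" "\<lambda>j. bb (2 * k - j)"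
        F "2 * \<epsilon> / \<delta>"], goal_cases)
    case (1 j)
    then obtain i where i: "2 * h + 3 - j = Suc (Suc i)" "2 * h + 3 - (j + 1) = Suc i"
      "2 * h + 3 - (j + 2) = i" "2 * k - (j + 1) = i"
      using len by (intro that[of "2 * h + 1 - j"]) auto
    show ?case unfolding i by (simp add: Y_def)
  next
    case (2 j)
    show ?case using bm by (simp add: bb_def)
  next
    case (3 j)
    then obtain i where i: "2 * h + 3 - (j + 1) = Suc i" "2 * h + 3 - (j + 2) = i"
      using len by (intro that[of "2 * h + 1 - j"]) auto
    show ?case unfolding i using Ydeg[of i] by blast
  next
    case 4
    show ?case using cqF1 by (simp add: numeral_3_eq_3)
  next
    case 5
    show ?case using nz char(5) by simp
  next
    case (6 \<sigma>)
    then show ?case by (intro that[of \<sigma>]) (auto simp: len)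
  qed
  show ?thesis
  proof (rule that[of \<sigma>])
    show "A F = [:0, lm ^ r / \<epsilon>:]" by (rule AF(1))
    show "\<sigma> 0 = 2 * \<epsilon> / \<delta>" by (rule \<sigma>(1))
    show "\<sigma> n \<noteq> 0" if "n < 2 * k" for n using \<sigma>(2) that by simp
    show "\<sigma> (n + 1) * \<sigma> n * (if n + 1 = k then a / 4 + m\<^sup>2 else a / 4) = 1" if "n + 1 < 2 * k" for n
    proof -
      have "2 * k - (n + 1) = h + 1 \<longleftrightarrow> n + 1 = k" using h that by auto
      then show ?thesis using \<sigma>(3)[of n] that unfolding b_def[symmetric] by (simp add: bb_def)
    qed
    show "A (F + n + 1) = [:\<sigma> n * (if n + 1 = k then m else if n = k then - m else 0), \<sigma> n:]"
      if "n < 2 * k" for n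
    proof -
      have "2 * k - (n + 1) = h + 1 \<longleftrightarrow> n + 1 = k" "2 * k - (n + 1) = h \<longleftrightarrow> n = k"
        using h that by auto
      then show ?thesis using \<sigma>(4)[of n] that by (simp add: mm_def)
    qed
    \<comment> \<open>\<open>s\<close> belongs to the complete quotient after the block; the product
      rule expresses it by the leading coefficient of the last partial quotient inside the
      block.\<close>
    define s where "s = \<sigma> (2 * k)"
    have s: "s \<noteq> 0" using \<sigma>(2)[of "2 * k"] by (simp add: s_def)
    have s_prev: "\<sigma> (2 * k - 1) = 4 / (a * s)"
    proof -
      have "s * \<sigma> (2 * k - 1) * (a / 4) = 1"
        using \<sigma>(3)[of "2 * k - 1"] k unfolding b_def[symmetric] by (simp add: bb_def s_def)
      then show ?thesis using s nz four by (simp add: field_simps)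
    qed
    have cqr: "complete_quotient A (F + r) = fls_const s * u / v"
      using \<sigma>(5) char(4) by (simp add: Y_def s_def add.assoc)
    have inv: "complete_quotient A (n + 1) ^ r = fls_const (2 / \<delta>) / \<zeta>"
      using nz char(5) by (simp add: \<zeta>_def Z_def divide_inverse)
    \<comment> \<open>With \<open>u\<close> and \<open>v\<close> inserted, \<open>P * u / v\<close>
      is affine in \<open>1 / \<zeta>\<close>, that is, in the \<open>r\<close>-th power of the next
      complete quotient.\<close>
    have "P * complete_quotient A (F + r) / fls_const s = fls_const d / \<zeta> - B"
      unfolding cqr u_def v_def using P \<zeta> s dnz by (simp add: field_simps)
    then have zinv: "1 / \<zeta> = (P * complete_quotient A (F + r) / fls_const s + B) / fls_const d"
      using dnz by (simp add: field_simps)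
    have coef_eqs: "fls_const (2 / \<delta>) / fls_const d / fls_const s = fls_const (\<delta> * \<sigma> (2 * k - 1) / (2 * D))"
      "fls_const (2 / \<delta>) / fls_const d * fls_const b * V = fls_const (- (\<delta> / D)) * Q"
      "fls_const (2 / \<delta>) / fls_const d * fls_const b * fls_const (m * N) = fls_const (c / D)"
    proof -
      show "fls_const (2 / \<delta>) / fls_const d / fls_const s = fls_const (\<delta> * \<sigma> (2 * k - 1) / (2 * D))"
        unfolding s_prev d using nz D(2) s four char(5)
        unfolding fls_const_divide_const
        by (intro arg_cong[of _ _ fls_const]) (simp add: field_simps power2_eq_square)
      have *: "fls_const (2 / \<delta>) / fls_const d * fls_const b = fls_const (\<delta> / (2 * D))"
        unfolding d b_def using nz D(2) four char(5)
        unfolding fls_const_divide_const fls_const_mult_const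
        by (intro arg_cong[of _ _ fls_const]) (simp add: field_simps power2_eq_square)
      show "fls_const (2 / \<delta>) / fls_const d * fls_const b * V = fls_const (- (\<delta> / D)) * Q"
        unfolding * PV(2) by (simp add: mult.assoc[symmetric] mult.commute[of D])
      show "fls_const (2 / \<delta>) / fls_const d * fls_const b * fls_const (m * N) = fls_const (c / D)"
        unfolding * mN hom using nz char(5) D(2) by (simp add: field_simps)
    qed
    have "complete_quotient A (n + 1) ^ r = fls_const (2 / \<delta>) * (1 / \<zeta>)"
      unfolding inv by simp
    also have "\<dots> = fls_const (2 / \<delta>) / fls_const d / fls_const s * P * complete_quotient A (F + r)
       + fls_const (2 / \<delta>) / fls_const d * fls_const b * V
       + fls_const (2 / \<delta>) / fls_const d * fls_const b * fls_const (m * N)"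
      unfolding zinv B_def by (simp add: algebra_simps add_divide_distrib del: fls_const_mult_const)
    finally show "complete_quotient A (n + 1) ^ r =
      fls_const (\<delta> * \<sigma> (2 * k - 1) / (2 * D)) * poly_to_fls (P_poly r a) * complete_quotient A (F + r)
      + fls_const (- (\<delta> / D)) * poly_to_fls (Q_poly r a) + fls_const (c / D)"
      unfolding coef_eqs P_def Q_def .
  qed
qed

section \<open>The self-similar recursion\<close>

text \<open>Here \<open>\<delta>\<close> and \<open>\<nu>\<close> are continued by the recursion of \<open>(C\<^sub>1)\<close> to all indices, beyond \<open>l\<close>.\<close>

locale hyperquadratic_cfrac =
  fixes p e r k l :: nat and a \<epsilon>1 \<epsilon>2 :: "'a::field"
    and \<alpha> :: "'a fls" and A :: "nat \<Rightarrow> 'a poly" and lam mu \<delta> \<nu> :: "nat \<Rightarrow> 'a"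
  assumes char: "CHAR('a) = p" "prime p" "r = p ^ e" "r = 2 * k + 1" "(2::'a) \<noteq> 0"
    and k: "k \<ge> 1" and l: "l \<ge> 1"
    and nonzero: "a \<noteq> 0" "\<epsilon>1 \<noteq> 0" "\<epsilon>2 \<noteq> 0"
    and cf: "has_cfrac \<alpha> A"
    and lam_def: "\<And>n. n \<ge> 1 \<Longrightarrow> lam n = coeff (A n) 1"
    and mu_def: "\<And>n. n \<ge> 1 \<Longrightarrow> mu n = coeff (A n) 0"
    and init: "\<And>i. 1 \<le> i \<Longrightarrow> i \<le> l \<Longrightarrow> lam i \<noteq> 0 \<and> A i = [:mu i, lam i:]"
    and equation: "\<alpha> ^ r =
      fls_const \<epsilon>1 * poly_to_fls (P_poly r a) * complete_quotient A (l + 1)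
      + fls_const \<epsilon>2 * poly_to_fls (Q_poly r a)"
    and delta_init: "\<And>i. 1 \<le> i \<Longrightarrow> i \<le> l \<Longrightarrow> \<delta> i \<noteq> 0"
    and denom_init: "\<And>i. 1 \<le> i \<Longrightarrow> i < l \<Longrightarrow> a ^ (r - 2) * (\<delta> i)\<^sup>2 + (\<nu> i - mu i ^ r)\<^sup>2 \<noteq> 0"
    and delta_1: "\<delta> 1 = a * lam 1 ^ r + \<epsilon>2" and nu_1: "\<nu> 1 = 0"
    and delta_Suc: "\<And>i. 1 \<le> i \<Longrightarrow> \<delta> (i + 1) = a * lam (i + 1) ^ r
        - \<delta> i / (a ^ (r - 2) * (\<delta> i)\<^sup>2 + (\<nu> i - mu i ^ r)\<^sup>2)"
    and nu_Suc: "\<And>i. 1 \<le> i \<Longrightarrow>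
      \<nu> (i + 1) = (\<nu> i - mu i ^ r) / (a ^ (r - 2) * (\<delta> i)\<^sup>2 + (\<nu> i - mu i ^ r)\<^sup>2)"
    and delta_l: "\<delta> l = - a * (\<epsilon>1 / \<epsilon>2) ^ r" and mu_l: "mu l ^ r = \<nu> l"
begin

section \<open>Invariants and the division of the indices into blocks\<close>

abbreviation "f \<equiv> f_map r l"
abbreviation "g \<equiv> g_map r l"

definition D :: "nat \<Rightarrow> 'a" where "D n = a ^ (r - 2) * (\<delta> n)\<^sup>2 + (\<nu> n - mu n ^ r)\<^sup>2"
definition w :: "nat \<Rightarrow> 'a" where "w n = a * lam n ^ r / \<delta> n"
definition z :: "nat \<Rightarrow> 'a" where "z n = (\<nu> n - mu n ^ r) / \<delta> n"
definition m :: "nat \<Rightarrow> 'a" where "m n = z n / (2 * (- a) ^ (k - 1))"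

text \<open>The coefficient of P_a in the relation at \<open>n\<close>, as
  \<open>cfrac_block\<close> leaves it for the preceding index; \<open>f (n - 1) + 2 * k\<close> is
  the last index of that block.\<close>

definition eps :: "nat \<Rightarrow> 'a" where
  "eps n = (if n = 1 then \<epsilon>1 else \<delta> (n - 1) * lam (f (n - 1) + 2 * k) / (2 * D (n - 1)))"

text \<open>The induction invariant: the relation at \<open>n\<close> with the nonvanishing
  conditions under which \<open>cfrac_block\<close> applies.\<close>

definition regular :: "nat \<Rightarrow> bool" where
  "regular n \<longleftrightarrow> \<delta> n \<noteq> 0 \<and> D n \<noteq> 0 \<and> lam n \<noteq> 0 \<and> A n = [:mu n, lam n:] \<and> eps n \<noteq> 0 \<and>
    complete_quotient A n ^ r =
      fls_const (eps n) * poly_to_fls (P_poly r a) * complete_quotient A (f n)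
      + fls_const (\<delta> n - a * lam n ^ r) * poly_to_fls (Q_poly r a) + fls_const (\<nu> n)"

definition pattern :: "nat \<Rightarrow> nat \<Rightarrow> bool" where
  "pattern i j \<longleftrightarrow> w (f i + j) = (if j = 0 then w i ^ r else 2) \<and>
    z (f i + j) = (if j = k then - (2 / a) * m i ^ r else 0)"

lemma four_nz: "(4::'a) \<noteq> 0"
  using char(5) by (metis mult_2 mult_eq_0_iff numeral_Bit0)

lemma r_add: "(x + y :: 'a) ^ r = x ^ r + y ^ r"
  using char by (intro power_r_add) auto

lemma two_r: "(2::'a) ^ r = 2"
  by (rule two_powers_char(1)[OF char])

lemma four_r: "(4::'a) ^ r = 4"
proof -
  have "(4::'a) ^ r = (2 * 2) ^ r" by simp
  also have "\<dots> = 4" unfolding power_mult_distrib two_r by simp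
  finally show ?thesis .
qed

lemma odd_r: "odd r" using char(4) by simp

lemma zero_r: "(0::'a) ^ r = 0" using odd_r by (simp add: odd_pos)

lemma minus_r: "(- x :: 'a) ^ r = - (x ^ r)"
  using odd_r by simp

lemma f_1: "f 1 = l + 1" by (simp add: f_map_def)

lemma f_Suc: "n \<ge> 1 \<Longrightarrow> f (n + 1) = f n + 2 * k + 1"
  using char(4) by (cases n) (auto simp: f_map_def)

lemma f_ge: "n \<ge> 1 \<Longrightarrow> n + l \<le> f n"
proof (induction n rule: dec_induct)
  case (step n)
  then show ?case using f_Suc[of n] by simp
qed (use f_1 in simp)

text \<open>\<open>g n\<close> is the middle of the block that starts at \<open>f n\<close>, where
  the twist sits.\<close>

lemma g_eq: "n \<ge> 1 \<Longrightarrow> g n = f n + k"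
  using char(4) by (cases n) (auto simp: f_map_def g_map_def)

text \<open>Consecutive values of \<open>f\<close> differ by \<open>2 * k + 1\<close>, so the blocks
  tile the indices beyond \<open>l\<close>.\<close>

lemma index_cases:
  assumes "n \<ge> l + 1"
  obtains i j where "i \<ge> 1" "j \<le> 2 * k" "n = f i + j"
proof -
  have "\<exists>i j. i \<ge> 1 \<and> j \<le> 2 * k \<and> n = f i + j"
    using assms
  proof (induction n rule: dec_induct)
    case base
    then show ?case using f_1 by (intro exI[of _ 1] exI[of _ 0]) auto
  next
    case (step n)
    then obtain i j where ij: "i \<ge> 1" "j \<le> 2 * k" "n = f i + j" by blast
    show ?case
    proof (cases "j = 2 * k")
      case True
      then show ?thesis using ij f_Suc[of i] by (intro exI[of _ "i + 1"] exI[of _ 0]) auto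
    next
      case False
      then show ?thesis using ij by (intro exI[of _ i] exI[of _ "j + 1"]) auto
    qed
  qed
  then show ?thesis using that by blast
qed

lemma D_eq: "\<delta> n \<noteq> 0 \<Longrightarrow> D n = (\<delta> n)\<^sup>2 * (a ^ (r - 2) + (z n)\<^sup>2)"
  by (simp add: D_def z_def field_simps)

lemma block:
  assumes n: "n \<ge> 1" and reg: "regular n"
  shows "A (f n) = [:0, lam n ^ r / eps n:]"
    and "lam (f n) = lam n ^ r / eps n" and "mu (f n) = 0" and "lam (f n) \<noteq> 0"
    and "lam (f n + 1) = 2 * eps n / \<delta> n"
    and "\<And>j. 1 \<le> j \<Longrightarrow> j \<le> 2 * k \<Longrightarrow> lam (f n + j) \<noteq> 0 \<and> A (f n + j) = [:mu (f n + j), lam (f n + j):]"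
    and "\<And>j. 1 \<le> j \<Longrightarrow> j \<le> 2 * k \<Longrightarrow>
      mu (f n + j) = lam (f n + j) * (if j = k then m n else if j = k + 1 then - m n else 0)"
    and "\<And>j. 1 \<le> j \<Longrightarrow> j < 2 * k \<Longrightarrow>
      lam (f n + j + 1) * lam (f n + j) * (if j = k then a / 4 + (m n)\<^sup>2 else a / 4) = 1"
    and "eps (n + 1) \<noteq> 0"
    and "complete_quotient A (n + 1) ^ r =
      fls_const (eps (n + 1)) * poly_to_fls (P_poly r a) * complete_quotient A (f (n + 1))
      + fls_const (\<delta> (n + 1) - a * lam (n + 1) ^ r) * poly_to_fls (Q_poly r a) + fls_const (\<nu> (n + 1))"
proof -
  have fn: "f n \<ge> 1" using f_ge[OF n] n by simp
  have reg': "\<delta> n \<noteq> 0" "D n \<noteq> 0" "lam n \<noteq> 0" "A n = [:mu n, lam n:]" "eps n \<noteq> 0"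
    "complete_quotient A n ^ r =
      fls_const (eps n) * poly_to_fls (P_poly r a) * complete_quotient A (f n)
      + fls_const (\<delta> n - a * lam n ^ r) * poly_to_fls (Q_poly r a) + fls_const (\<nu> n)"
    using reg by (auto simp: regular_def)
  have mn: "m n = (\<nu> n - mu n ^ r) / (2 * \<delta> n * (- a) ^ (k - 1))"
    by (simp add: m_def z_def mult_ac)
  obtain \<sigma> where \<sigma>: "A (f n) = [:0, lam n ^ r / eps n:]" "\<sigma> 0 = 2 * eps n / \<delta> n"
    "\<And>j. j < 2 * k \<Longrightarrow> \<sigma> j \<noteq> 0"
    "\<And>j. j + 1 < 2 * k \<Longrightarrow> \<sigma> (j + 1) * \<sigma> j * (if j + 1 = k then a / 4 + (m n)\<^sup>2 else a / 4) = 1"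
    "\<And>j. j < 2 * k \<Longrightarrow>
      A (f n + j + 1) = [:\<sigma> j * (if j + 1 = k then m n else if j = k then - m n else 0), \<sigma> j:]"
    "complete_quotient A (n + 1) ^ r =
      fls_const (\<delta> n * \<sigma> (2 * k - 1) / (2 * D n)) * poly_to_fls (P_poly r a) * complete_quotient A (f n + r)
      + fls_const (- (\<delta> n / D n)) * poly_to_fls (Q_poly r a) + fls_const ((\<nu> n - mu n ^ r) / D n)"
    using cfrac_block[OF char k cf n fn reg'(4,6) nonzero(1) reg'(5,3,1) refl D_def[of n] reg'(2) mn] by blast
  show "A (f n) = [:0, lam n ^ r / eps n:]" by (rule \<sigma>(1))
  then show lf: "lam (f n) = lam n ^ r / eps n" and "mu (f n) = 0"
    using lam_def[OF fn] mu_def[OF fn] by simp_all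
  then show "lam (f n) \<noteq> 0" using reg' by simp
  have A: "A (f n + j) = [:\<sigma> (j - 1) * (if j = k then m n else if j = k + 1 then - m n else 0), \<sigma> (j - 1):]"
    if "1 \<le> j" "j \<le> 2 * k" for j
    using \<sigma>(5)[of "j - 1"] that by (cases j) auto
  have lam: "lam (f n + j) = \<sigma> (j - 1)" if "1 \<le> j" "j \<le> 2 * k" for j
    using A[OF that] lam_def[of "f n + j"] fn by simp
  show mu: "mu (f n + j) = lam (f n + j) * (if j = k then m n else if j = k + 1 then - m n else 0)"
    if "1 \<le> j" "j \<le> 2 * k" for j
    using A[OF that] lam[OF that] mu_def[of "f n + j"] fn by simp
  show "lam (f n + 1) = 2 * eps n / \<delta> n"
    using lam[of 1] k \<sigma>(2) by simp
  show lam_A: "lam (f n + j) \<noteq> 0 \<and> A (f n + j) = [:mu (f n + j), lam (f n + j):]"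
    if "1 \<le> j" "j \<le> 2 * k" for j
    using A[OF that] mu[OF that] lam[OF that] \<sigma>(3)[of "j - 1"] that by simp
  show "lam (f n + j + 1) * lam (f n + j) * (if j = k then a / 4 + (m n)\<^sup>2 else a / 4) = 1"
    if "1 \<le> j" "j < 2 * k" for j
    using \<sigma>(4)[of "j - 1"] that lam[of j] lam[of "j + 1"] by simp
  have eps: "eps (n + 1) = \<delta> n * \<sigma> (2 * k - 1) / (2 * D n)"
    using n lam[of "2 * k"] k by (simp add: eps_def)
  show "eps (n + 1) \<noteq> 0"
    using eps reg' \<sigma>(3)[of "2 * k - 1"] k char(5) by simp
  have "f (n + 1) = f n + r" using f_Suc[OF n] char(4) by simp
  moreover have "\<delta> (n + 1) - a * lam (n + 1) ^ r = - (\<delta> n / D n)"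
    using delta_Suc[OF n] by (simp add: D_def)
  moreover have "\<nu> (n + 1) = (\<nu> n - mu n ^ r) / D n"
    using nu_Suc[OF n] by (simp add: D_def)
  ultimately show "complete_quotient A (n + 1) ^ r =
      fls_const (eps (n + 1)) * poly_to_fls (P_poly r a) * complete_quotient A (f (n + 1))
      + fls_const (\<delta> (n + 1) - a * lam (n + 1) ^ r) * poly_to_fls (Q_poly r a) + fls_const (\<nu> (n + 1))"
    using \<sigma>(6) eps by simp
qed

text \<open>The three product lemmas treat the border between blocks, the first step inside a block,
  and the remaining steps. At the border \<open>eps (i + 1)\<close> contains the last leading
  coefficient of the block before, and the recursion for \<delta> brings in
  \<open>w (i + 1)\<close>.\<close>

lemma lam_product_0:
  assumes "i \<ge> 1" "regular i" "regular (i + 1)"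
  shows "lam (f (i + 1)) * lam (f i + 2 * k) = 2 / a / (1 - 1 / w (i + 1))"
proof -
  have nz: "\<delta> i \<noteq> 0" "D i \<noteq> 0" "lam (i + 1) \<noteq> 0" "\<delta> (i + 1) \<noteq> 0"
    "lam (f i + 2 * k) \<noteq> 0"
    using assms block(6)[of i "2 * k"] k by (auto simp: regular_def)
  have "eps (i + 1) = \<delta> i * lam (f i + 2 * k) / (2 * D i)"
    using assms(1) by (simp add: eps_def)
  then have "lam (f (i + 1)) = lam (i + 1) ^ r / (\<delta> i * lam (f i + 2 * k) / (2 * D i))"
    using block(2)[of "i + 1"] assms by simp
  then have product: "lam (f (i + 1)) * lam (f i + 2 * k) = 2 * lam (i + 1) ^ r * D i / \<delta> i"
    using nz char(5) by simp
  have "1 - 1 / w (i + 1) = (a * lam (i + 1) ^ r - \<delta> (i + 1)) / (a * lam (i + 1) ^ r)"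
    using nz nonzero by (simp add: w_def field_simps)
  also have "a * lam (i + 1) ^ r - \<delta> (i + 1) = \<delta> i / D i"
    using delta_Suc[OF assms(1)] by (simp add: D_def)
  finally show ?thesis unfolding product using nz nonzero by simp
qed

lemma lam_product_1:
  assumes "i \<ge> 1" "regular i"
  shows "lam (f i + 1) * lam (f i) = 2 / a * w i"
  unfolding block(2,5)[OF assms] using assms(2) nonzero by (simp add: regular_def w_def)

lemma lam_product_2:
  assumes "i \<ge> 1" "regular i" "1 \<le> j" "j < 2 * k"
  shows "lam (f i + j + 1) * lam (f i + j) = 1 / (if j = k then a / 4 + (m i)\<^sup>2 else a / 4)"
    and "(if j = k then a / 4 + (m i)\<^sup>2 else a / 4) \<noteq> 0"
proof -
  let ?b = "if j = k then a / 4 + (m i)\<^sup>2 else a / 4"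
  have *: "lam (f i + j + 1) * lam (f i + j) * ?b = 1" by (rule block(8)[OF assms])
  show nz: "?b \<noteq> 0"
  proof
    assume zero: "?b = 0"
    from * show False unfolding zero by simp
  qed
  show "lam (f i + j + 1) * lam (f i + j) = 1 / ?b"
    unfolding nonzero_eq_divide_eq[OF nz] by (rule *)
qed

text \<open>The recursion for \<delta> in terms of \<open>w\<close>, \<open>z\<close> and the
  product of two neighbouring leading coefficients, which the product lemmas supply.\<close>

lemma delta_step:
  assumes "n \<ge> 1" "regular n" "lam (n + 1) \<noteq> 0"
  shows "\<delta> (n + 1) = a * lam (n + 1) ^ r *
    (1 - w n / (a\<^sup>2 * (lam (n + 1) * lam n) ^ r * (a ^ (r - 2) + (z n)\<^sup>2)))"
proof -
  have nz: "\<delta> n \<noteq> 0" "D n \<noteq> 0" "lam n \<noteq> 0" using assms by (auto simp: regular_def)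
  define s where "s = a ^ (r - 2) + (z n)\<^sup>2"
  have s: "s \<noteq> 0" "D n = (\<delta> n)\<^sup>2 * s"
    using nz D_eq[of n] by (auto simp: s_def)
  have "\<delta> (n + 1) = a * lam (n + 1) ^ r - \<delta> n / D n"
    using delta_Suc[OF assms(1)] by (simp add: D_def)
  also have "\<delta> n / D n = a * lam (n + 1) ^ r * (w n / (a\<^sup>2 * (lam (n + 1) * lam n) ^ r * s))"
    unfolding s(2) w_def using nz s(1) assms(3) nonzero
    by (simp add: field_simps power2_eq_square)
  finally show ?thesis by (simp add: s_def algebra_simps)
qed

lemma w_step:
  assumes "n \<ge> 1" "regular n" "lam (n + 1) \<noteq> 0" "x \<noteq> 0"
    and "1 - w n / (a\<^sup>2 * (lam (n + 1) * lam n) ^ r * (a ^ (r - 2) + (z n)\<^sup>2)) = 1 / x"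
  shows "\<delta> (n + 1) \<noteq> 0" "w (n + 1) = x"
proof -
  have "\<delta> (n + 1) = a * lam (n + 1) ^ r * (1 / x)"
    using delta_step[OF assms(1-3)] unfolding assms(5) .
  then show "\<delta> (n + 1) \<noteq> 0" "w (n + 1) = x"
    using assms(3,4) nonzero by (simp_all add: w_def)
qed

section \<open>Frobenius identities and the induction over all indices\<close>

lemma a_power_r: "a ^ r = a\<^sup>2 * a ^ (r - 2)"
proof -
  have "r = 2 + (r - 2)" using char(4) k by simp
  then show ?thesis by (metis power_add)
qed

lemma middle_power_r: "(a / 4 + (m i)\<^sup>2) ^ r = (a ^ r + 4 * (m i ^ r)\<^sup>2) / 4"
  using four_nz by (simp add: r_add power_divide four_r power_mult[symmetric] mult.commute add_divide_distrib)

lemma middle_nz: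
  assumes "i \<ge> 1" "regular i"
  shows "a / 4 + (m i)\<^sup>2 \<noteq> 0"
  using lam_product_2(2)[OF assms, of k] k by simp

text \<open>Frobenius carries the exceptional coefficient of block \<open>i\<close> to the
  denominator at its middle index \<open>g i\<close>, so that denominator is nonzero and cancels
  against the product of leading coefficients.\<close>

lemma denom_z: "a\<^sup>2 * (a ^ (r - 2) + (- (2 / a) * m i ^ r)\<^sup>2) = 4 * (a / 4 + (m i)\<^sup>2) ^ r"
  unfolding middle_power_r a_power_r using nonzero four_nz by (simp add: field_simps power2_eq_square)

lemma regular_1: "regular 1"
proof -
  have "a ^ (r - 2) * (\<delta> 1)\<^sup>2 + (\<nu> 1 - mu 1 ^ r)\<^sup>2 \<noteq> 0"
    \<comment> \<open>For \<open>l = 1\<close> the denominator is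
      \<open>a ^ (r - 2) * (\<delta> 1)\<^sup>2\<close> by (C_3).\<close>
    using denom_init[of 1] delta_init[of 1] l mu_l nonzero by (cases "l = 1") auto
  then show ?thesis
    using delta_init[of 1] init[of 1] l nonzero equation complete_quotient_1[OF cf] f_1 delta_1 nu_1
    by (simp add: regular_def D_def eps_def)
qed

text \<open>The role of \<open>(C\<^sub>2)\<close>: by Frobenius, \<open>\<delta>\<^sub>l\<^sub>+\<^sub>1\<close> becomes a multiple of \<open>\<delta>\<^sub>1\<^sup>r = (a \<lambda>\<^sub>1\<^sup>r + \<epsilon>\<^sub>2)\<^sup>r\<close>.\<close>

lemma w_l_Suc:
  assumes "regular l" "regular 1" "lam (l + 1) = lam 1 ^ r / \<epsilon>1"
  shows "\<delta> (l + 1) \<noteq> 0" "w (l + 1) = w 1 ^ r"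
proof -
  have nz: "\<delta> 1 \<noteq> 0" "lam 1 \<noteq> 0" "\<delta> l \<noteq> 0" using assms by (auto simp: regular_def)
  have "\<delta> (l + 1) = a * lam (l + 1) ^ r - \<delta> l / (a ^ (r - 2) * (\<delta> l)\<^sup>2)"
    using delta_Suc[OF l] mu_l by simp
  also have "\<delta> l / (a ^ (r - 2) * (\<delta> l)\<^sup>2) = 1 / (a ^ (r - 2) * \<delta> l)"
    using nz by (simp add: power2_eq_square)
  also have "\<dots> = - (a * (\<epsilon>2 ^ r / (a ^ r * \<epsilon>1 ^ r)))"
    unfolding delta_l a_power_r using nonzero by (simp add: power_divide power2_eq_square field_simps)
  finally have "\<delta> (l + 1) = a * ((lam 1 ^ r) ^ r / \<epsilon>1 ^ r) + a * (\<epsilon>2 ^ r / (a ^ r * \<epsilon>1 ^ r))"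
    unfolding assms(3) by (simp add: power_divide)
  also have "\<dots> = a * ((a * lam 1 ^ r) ^ r + \<epsilon>2 ^ r) / (a ^ r * \<epsilon>1 ^ r)"
    using nonzero by (simp add: power_mult_distrib field_simps)
  also have "(a * lam 1 ^ r) ^ r + \<epsilon>2 ^ r = \<delta> 1 ^ r"
    unfolding delta_1 r_add ..
  finally have d: "\<delta> (l + 1) = a * \<delta> 1 ^ r / (a ^ r * \<epsilon>1 ^ r)" .
  then show "\<delta> (l + 1) \<noteq> 0" using nz nonzero by simp
  show "w (l + 1) = w 1 ^ r"
    unfolding w_def d assms(3) using nz nonzero
    by (simp add: power_divide power_mult_distrib field_simps)
qed

text \<open>Beyond \<open>l\<close>, index \<open>n + 1\<close> lies in the block of some
  \<open>i \<le> n\<close>, because \<open>f i\<close> is at least \<open>i + l\<close>. That block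
  gives the partial quotient; \<delta> and \<nu> follow from \<open>w\<close> and \<open>z\<close>
  at \<open>n\<close>.\<close>

lemma regular_step:
  assumes n: "n \<ge> 1"
    and reg: "\<And>i. 1 \<le> i \<Longrightarrow> i \<le> n \<Longrightarrow> regular i"
    and pat: "\<And>i j. 1 \<le> i \<Longrightarrow> j \<le> 2 * k \<Longrightarrow> f i + j \<le> n \<Longrightarrow> pattern i j"
  shows "regular (n + 1)"
    and "\<And>i j. 1 \<le> i \<Longrightarrow> j \<le> 2 * k \<Longrightarrow> f i + j = n + 1 \<Longrightarrow> pattern i j"
proof -
  have reg_n: "regular n" using reg n by simp
  have core: "lam (n + 1) \<noteq> 0 \<and> A (n + 1) = [:mu (n + 1), lam (n + 1):] \<and> \<delta> (n + 1) \<noteq> 0 \<and>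
      D (n + 1) \<noteq> 0 \<and> pattern i j"
    if i: "1 \<le> i" and j: "j \<le> 2 * k" and ij: "f i + j = n + 1" for i j
  proof -
    have "i \<le> n" using f_ge[OF i] l ij by simp
    then have reg_i: "regular i" using reg i by simp
    have lam_A: "lam (n + 1) \<noteq> 0 \<and> A (n + 1) = [:mu (n + 1), lam (n + 1):]"
    proof (cases "j = 0")
      case True
      then show ?thesis using block(1-4)[OF i reg_i] ij by simp
    next
      case False
      then show ?thesis using block(6)[OF i reg_i, of j] j unfolding ij by simp
    qed
    have nz: "lam (n + 1) \<noteq> 0" "lam n \<noteq> 0" "\<delta> n \<noteq> 0"
      using lam_A reg_n by (auto simp: regular_def)
    \<comment> \<open>Index \<open>n\<close> is position \<open>j - 1\<close> of the same block, the
      last position of the block before, or \<open>l\<close>, where (C_3) gives 0.\<close>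
    have z_n: "z n = (if j = k + 1 then - (2 / a) * m i ^ r else 0)"
    proof (cases "j = 0")
      case True
      show ?thesis
      proof (cases "i = 1")
        case True
        then have "n = l" using \<open>j = 0\<close> ij f_1 by simp
        then show ?thesis using mu_l \<open>j = 0\<close> by (simp add: z_def)
      next
        case False
        then obtain i' where i': "i = i' + 1" "i' \<ge> 1" using i by (intro that[of "i - 1"]) auto
        then have "n = f i' + 2 * k" using ij True f_Suc[of i'] by simp
        then show ?thesis using pat[of i' "2 * k"] i' k True by (simp add: pattern_def)
      qed
    next
      case False
      then have "n = f i + (j - 1)" "j - 1 \<le> 2 * k" using ij j by auto
      then show ?thesis using pat[of i "j - 1"] i False by (auto simp: pattern_def)
    qed
    have w_part: "\<delta> (n + 1) \<noteq> 0 \<and> w (n + 1) = (if j = 0 then w i ^ r else 2)"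
    proof -
      consider (base) "j = 0" "i = 1" | (zero) i' where "j = 0" "i = i' + 1" "i' \<ge> 1"
        | (one) "j = 1" | (more) "j \<ge> 2"
      proof -
        have "j = 0 \<or> j = 1 \<or> j \<ge> 2" "i = 1 \<or> i = (i - 1) + 1 \<and> i - 1 \<ge> 1" using i by auto
        then show ?thesis using that by blast
      qed
      then show ?thesis
      proof cases
        case base
        then have "n = l" using ij f_1 by simp
        moreover have "lam (l + 1) = lam 1 ^ r / \<epsilon>1"
          using block(2)[of 1] regular_1 f_1 by (simp add: eps_def)
        ultimately show ?thesis using w_l_Suc reg_n regular_1 base by simp
      next
        case zero
        have n': "n = f i' + 2 * k" using ij zero f_Suc[of i'] by simp
        have w_n: "w n = 2"
          using pat[of i' "2 * k"] zero n' k by (simp add: pattern_def)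
        have reg': "regular i'" using reg[of i'] zero \<open>i \<le> n\<close> by simp
        define y where "y = 1 - 1 / w i"
        have "lam (n + 1) * lam n = 2 / a / y"
          using lam_product_0[of i'] zero reg' reg_i ij unfolding n' y_def by simp
        then have "a\<^sup>2 * (lam (n + 1) * lam n) ^ r * (a ^ (r - 2) + (z n)\<^sup>2)
            = a ^ r * (2 / a / y) ^ r"
          using zero unfolding z_n by (simp add: a_power_r)
        also have "\<dots> = 2 / y ^ r"
          using nonzero by (simp add: power_divide power_mult_distrib two_r)
        finally have "1 - w n / (a\<^sup>2 * (lam (n + 1) * lam n) ^ r * (a ^ (r - 2) + (z n)\<^sup>2))
            = 1 - y ^ r"
          using char(5) by (simp add: w_n)
        \<comment> \<open>\<open>1 - y\<close> is \<open>1 / w i\<close>, so Frobenius gives the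
          inverse of \<open>w i ^ r\<close>.\<close>
        also have "\<dots> = (1 + - y) ^ r" unfolding r_add minus_r by simp
        also have "\<dots> = 1 / w i ^ r" by (simp add: y_def power_divide)
        finally show ?thesis
          using w_step[OF n reg_n nz(1), of "w i ^ r"] reg_i zero(1) nonzero
          by (simp add: w_def regular_def)
      next
        case one
        then have n': "n = f i" using ij by simp
        have w_n: "w n = w i ^ r"
          using pat[of i 0] i k n' by (simp add: pattern_def)
        have w_i: "w i \<noteq> 0" using reg_i nonzero by (simp add: w_def regular_def)
        have "lam (n + 1) * lam n = 2 / a * w i"
          using lam_product_1[OF i reg_i] n' by simp
        then have "a\<^sup>2 * (lam (n + 1) * lam n) ^ r * (a ^ (r - 2) + (z n)\<^sup>2)
            = a ^ r * (2 / a * w i) ^ r"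
          using one k unfolding z_n by (simp add: a_power_r)
        also have "\<dots> = 2 * w i ^ r"
          using nonzero by (simp add: power_divide power_mult_distrib two_r)
        finally have "1 - w n / (a\<^sup>2 * (lam (n + 1) * lam n) ^ r * (a ^ (r - 2) + (z n)\<^sup>2))
            = 1 - 1 / 2"
          using w_i by (simp add: w_n)
        also have "\<dots> = 1 / 2" using char(5) by (simp add: field_simps)
        finally show ?thesis
          using w_step[OF n reg_n nz(1), of 2] char(5) one by simp
      next
        case more
        define j' where "j' = j - 1"
        have n': "n = f i + j'" "1 \<le> j'" "j' < 2 * k" using more ij j by (auto simp: j'_def)
        have w_n: "w n = 2"
          using pat[of i j'] i n' by (simp add: pattern_def)
        have z_n': "z n = (if j' = k then - (2 / a) * m i ^ r else 0)"
          unfolding z_n using more by (auto simp: j'_def)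
        \<comment> \<open>Plain and exceptional steps agree from here: the denominator is
          \<open>4 * B ^ r\<close> in both, and the leading coefficients contribute
          \<open>(1 / B) ^ r\<close>.\<close>
        define B where "B = (if j' = k then a / 4 + (m i)\<^sup>2 else a / 4)"
        have B: "lam (n + 1) * lam n = 1 / B" "B \<noteq> 0"
          using lam_product_2[OF i reg_i n'(2,3)] unfolding n'(1) B_def by simp_all
        have "a\<^sup>2 * (a ^ (r - 2) + (z n)\<^sup>2) = 4 * B ^ r"
        proof (cases "j' = k")
          case True
          then show ?thesis using denom_z[of i] by (simp add: z_n' B_def)
        next
          case False
          then show ?thesis
            using four_nz by (simp add: z_n' B_def power_divide four_r a_power_r)
        qed
        then have "(a\<^sup>2 * (a ^ (r - 2) + (z n)\<^sup>2)) * (lam (n + 1) * lam n) ^ r = 4 * B ^ r * (1 / B) ^ r"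
          unfolding B(1) by simp
        then have "a\<^sup>2 * (lam (n + 1) * lam n) ^ r * (a ^ (r - 2) + (z n)\<^sup>2) = 4 * B ^ r * (1 / B) ^ r"
          by (simp only: mult_ac)
        also have "\<dots> = 4" using B(2) by (simp add: power_divide)
        finally have "1 - w n / (a\<^sup>2 * (lam (n + 1) * lam n) ^ r * (a ^ (r - 2) + (z n)\<^sup>2)) = 1 - 2 / 4"
          by (simp only: w_n)
        also have "\<dots> = 1 / 2"
        proof -
          have "(4 :: 'a) = 2 * 2" by simp
          then show ?thesis using char(5) four_nz by (simp add: field_simps)
        qed
        finally show ?thesis
          using w_step[OF n reg_n nz(1), of 2] char(5) more by simp
      qed
    qed
    have w_2: "a * lam (n + 1) ^ r = 2 * \<delta> (n + 1)" if "j \<noteq> 0"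
      using w_part that by (auto simp: w_def nonzero_divide_eq_eq)
    have nu_mu: "z (n + 1) = (if j = k then - (2 / a) * m i ^ r else 0)"
    proof -
      consider "j = 0" | "j \<noteq> 0" "j = k" | "j = k + 1" | "j \<noteq> 0" "j \<noteq> k" "j \<noteq> k + 1" by blast
      then show ?thesis
      proof cases
        case 1
        then have "mu (n + 1) = 0" using block(3)[OF i reg_i] ij by simp
        moreover have "\<nu> (n + 1) = 0"
          using nu_Suc[OF n] z_n 1 k nz by (simp add: z_def)
        ultimately show ?thesis using 1 k zero_r by (simp add: z_def)
      next
        case 2
        then have mu: "mu (n + 1) = lam (n + 1) * m i" using block(7)[OF i reg_i, of j] j unfolding ij by simp
        have "\<nu> (n + 1) = 0"
          using nu_Suc[OF n] z_n 2 nz by (simp add: z_def)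
        then have "z (n + 1) = - (lam (n + 1) ^ r * m i ^ r) / \<delta> (n + 1)"
          unfolding z_def mu power_mult_distrib by simp
        also have "lam (n + 1) ^ r = 2 * \<delta> (n + 1) / a"
          using w_2 2 nonzero by (simp add: field_simps)
        finally show ?thesis using 2 w_part by simp
      next
        \<comment> \<open>Just after the middle, a nonzero \<open>z n\<close> makes \<nu> nonzero,
          but the opposite constant term of the twist has exactly this \<open>r\<close>-th power, so
          \<open>z\<close> vanishes again.\<close>
        case 3
        then have mu: "mu (n + 1) = - (lam (n + 1) * m i)" using block(7)[OF i reg_i, of j] j unfolding ij by simp
        have n': "n = f i + k" "k < 2 * k" using 3 ij k by auto
        define B where "B = a / 4 + (m i)\<^sup>2"
        have B: "lam (n + 1) * lam n = 1 / B" "B \<noteq> 0"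
          using lam_product_2[OF i reg_i k n'(2)] unfolding n'(1) B_def by simp_all
        have "w n = 2" using pat[of i k] i n' k by (simp add: pattern_def)
        then have \<delta>_n: "\<delta> n = a * lam n ^ r / 2" using nz char(5) by (simp add: w_def field_simps)
        define M where "M = m i ^ r"
        have s: "a\<^sup>2 * (a ^ (r - 2) + (- (2 / a) * M)\<^sup>2) = 4 * B ^ r"
          using denom_z[of i] by (simp add: B_def M_def)
        have "\<nu> (n + 1) = z n * \<delta> n / D n"
          using nu_Suc[OF n] nz by (simp add: z_def D_def)
        also have "\<dots> = - (2 / a) * M / (\<delta> n * (a ^ (r - 2) + (- (2 / a) * M)\<^sup>2))"
          unfolding D_eq[OF nz(3)] using 3 nz by (simp add: z_n M_def power2_eq_square)
        also have "\<dots> = - 4 * M / (lam n ^ r * (a\<^sup>2 * (a ^ (r - 2) + (- (2 / a) * M)\<^sup>2)))"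
        proof -
          define s where "s = a ^ (r - 2) + (- (2 / a) * M)\<^sup>2"
          have "- (2 / a) * M / (a * lam n ^ r / 2 * s) = - 4 * M / (lam n ^ r * (a\<^sup>2 * s))"
            using char(5) nonzero by (simp add: divide_simps power2_eq_square)
          then show ?thesis unfolding \<delta>_n s_def .
        qed
        also have "\<dots> = - (M / (lam n ^ r * B ^ r))"
          unfolding s using four_nz by (simp add: divide_simps)
        also have "\<dots> = - (M * lam (n + 1) ^ r)"
        proof -
          have "lam (n + 1) = 1 / (lam n * B)"
            using B nz by (simp add: field_simps)
          then show ?thesis by (simp add: power_divide power_mult_distrib)
        qed
        finally have "\<nu> (n + 1) = mu (n + 1) ^ r"
          unfolding mu minus_r power_mult_distrib M_def by (simp add: mult.commute)
        then show ?thesis using 3 by (simp add: z_def)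
      next
        case 4
        then have "mu (n + 1) = 0" using block(7)[OF i reg_i, of j] j unfolding ij by simp
        moreover have "\<nu> (n + 1) = 0"
          using nu_Suc[OF n] z_n 4 nz by (simp add: z_def)
        ultimately show ?thesis using 4 zero_r by (simp add: z_def)
      qed
    qed
    have "a ^ (r - 2) + (z (n + 1))\<^sup>2 \<noteq> 0"
    proof (cases "j = k")
      case True
      then show ?thesis
        using denom_z[of i] middle_nz[OF i reg_i] four_nz unfolding nu_mu by auto
    next
      case False
      then show ?thesis unfolding nu_mu using nonzero by simp
    qed
    then have "D (n + 1) \<noteq> 0" using D_eq[of "n + 1"] w_part by simp
    moreover have "pattern i j" using w_part nu_mu unfolding pattern_def ij by simp
    ultimately show ?thesis using lam_A w_part by blast
  qed
  then show "\<And>i j. 1 \<le> i \<Longrightarrow> j \<le> 2 * k \<Longrightarrow> f i + j = n + 1 \<Longrightarrow> pattern i j" by blast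
  have "lam (n + 1) \<noteq> 0 \<and> A (n + 1) = [:mu (n + 1), lam (n + 1):] \<and> \<delta> (n + 1) \<noteq> 0 \<and> D (n + 1) \<noteq> 0"
  proof (cases "n + 1 \<le> l")
    case True
    have "D (n + 1) \<noteq> 0"
    proof (cases "n + 1 = l")
      case True
      then show ?thesis using mu_l delta_init[of l] l nonzero by (simp add: D_def)
    next
      case False
      then show ?thesis using denom_init[of "n + 1"] True by (simp add: D_def)
    qed
    then show ?thesis using init[of "n + 1"] delta_init[of "n + 1"] True by simp
  next
    case False
    then have "l + 1 \<le> n + 1" by simp
    then obtain i j where "1 \<le> i" "j \<le> 2 * k" "n + 1 = f i + j" by (rule index_cases)
    then show ?thesis using core[of i j] by simp
  qed
  then show "regular (n + 1)"
    using block(9,10)[OF n reg_n] unfolding regular_def by blast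
qed

lemma regular_pattern:
  "(\<forall>i. 1 \<le> i \<and> i \<le> n + 1 \<longrightarrow> regular i) \<and>
   (\<forall>i j. 1 \<le> i \<and> j \<le> 2 * k \<and> f i + j \<le> n + 1 \<longrightarrow> pattern i j)"
proof (induction n)
  case 0
  \<comment> \<open>Blocks start at \<open>l + 1\<close>, which exceeds 1, so no pattern is claimed
    yet.\<close>
  have "\<not> f i + j \<le> 0 + 1" if "1 \<le> i" for i j
    using f_ge[OF that] that l by simp
  then show ?case using regular_1 by (metis add_0 le_antisym)
next
  case (Suc n)
  note step = regular_step[of "n + 1"]
  have "regular (n + 1 + 1)"
    by (rule step(1)) (use Suc in auto)
  moreover have "pattern i j" if "1 \<le> i" "j \<le> 2 * k" "f i + j = n + 1 + 1" for i j
    by (rule step(2)) (use Suc that in auto)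
  ultimately show ?case using Suc by (auto simp: le_Suc_eq)
qed

lemma regular: "1 \<le> i \<Longrightarrow> regular i"
  using regular_pattern[of i] by simp

lemma w_f: "1 \<le> i \<Longrightarrow> w (f i) = w i ^ r"
  and w_f_plus: "1 \<le> i \<Longrightarrow> 1 \<le> j \<Longrightarrow> j \<le> 2 * k \<Longrightarrow> w (f i + j) = 2"
  and z_f_plus: "1 \<le> i \<Longrightarrow> j \<le> 2 * k \<Longrightarrow> j \<noteq> k \<Longrightarrow> z (f i + j) = 0"
  and z_g: "1 \<le> i \<Longrightarrow> z (g i) = - (2 / a) * m i ^ r"
proof -
  have *: "1 \<le> i \<Longrightarrow> j \<le> 2 * k \<Longrightarrow> pattern i j" for i j
    using regular_pattern[of "f i + j"] by simp
  show "1 \<le> i \<Longrightarrow> w (f i) = w i ^ r" using *[of i 0] by (simp add: pattern_def)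
  show "1 \<le> i \<Longrightarrow> 1 \<le> j \<Longrightarrow> j \<le> 2 * k \<Longrightarrow> w (f i + j) = 2" using *[of i j] by (simp add: pattern_def)
  show "1 \<le> i \<Longrightarrow> j \<le> 2 * k \<Longrightarrow> j \<noteq> k \<Longrightarrow> z (f i + j) = 0" using *[of i j] by (simp add: pattern_def)
  show "1 \<le> i \<Longrightarrow> z (g i) = - (2 / a) * m i ^ r" using *[of i k] by (simp add: pattern_def g_eq)
qed

end

section \<open>Closed forms along the iterates of \<open>f\<close> and \<open>g\<close>\<close>

lemma odd_succ_half: "odd x \<Longrightarrow> (x + 1) div 2 * 2 = x + 1" for x :: int
  by presburger

context hyperquadratic_cfrac
begin

lemma r_pow_add: "(x + y :: 'a) ^ (r ^ t) = x ^ (r ^ t) + y ^ (r ^ t)"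
proof -
  have "r ^ t = p ^ (e * t)" using char(3) by (simp add: power_mult)
  then show ?thesis using power_r_add[OF char(1,2), of "r ^ t"] by blast
qed

lemma r_pow_diff: "(x - y :: 'a) ^ (r ^ t) = x ^ (r ^ t) - y ^ (r ^ t)"
  using r_pow_add[of "x - y" y t] by simp

lemma funpow_ge_1:
  fixes h :: "nat \<Rightarrow> nat"
  assumes "\<And>n. 1 \<le> n \<Longrightarrow> 1 \<le> h n" "1 \<le> i"
  shows "1 \<le> (h ^^ t) i"
  using assms by (induction t) auto

lemma funpow_pred: "1 \<le> t \<Longrightarrow> (h ^^ t) i = h ((h ^^ (t - 1)) i)"
  by (cases t) auto

lemma f_ge_1: "1 \<le> n \<Longrightarrow> 1 \<le> f n"
  using f_ge[of n] by simp

lemma g_ge_1: "1 \<le> n \<Longrightarrow> 1 \<le> g n"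
  using f_ge[of n] g_eq[of n] by simp

lemma f_iter_ge_1: "1 \<le> i \<Longrightarrow> 1 \<le> (f ^^ t) i"
  using f_ge_1 by (rule funpow_ge_1)

lemma g_iter_ge_1: "1 \<le> i \<Longrightarrow> 1 \<le> (g ^^ t) i"
  using g_ge_1 by (rule funpow_ge_1)

lemma nondegenerate: "1 \<le> n \<Longrightarrow> lam n \<noteq> 0 \<and> A n = [:mu n, lam n:] \<and> \<delta> n \<noteq> 0"
  using regular[of n] by (simp add: regular_def)

lemma F_setI: "i \<in> {1..l} \<Longrightarrow> f ((f ^^ t) i) \<in> F_set r l"
  unfolding F_set_def by (rule CollectI, rule exI[of _ "Suc t"], rule exI[of _ i]) simp

lemma G_setI: "i \<in> I_star r l mu \<nu> \<Longrightarrow> g ((g ^^ t) i) \<in> G_set r l mu \<nu>"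
  unfolding G_set_def by (rule CollectI, rule exI[of _ "Suc t"], rule exI[of _ i]) simp

lemma w_f_iter: "1 \<le> i \<Longrightarrow> w ((f ^^ t) i) = w i ^ (r ^ t)"
proof (induction t)
  case (Suc t)
  then show ?case
    using w_f[OF f_iter_ge_1[of i t]] by (simp add: power_mult[symmetric] mult.commute)
qed simp

text \<open>Descent: away from block starts the value is 2, and at \<open>f i\<close> it is the
  \<open>r\<close>-th power of the value at the smaller index \<open>i\<close>, where Frobenius
  fixes 2. The iterate \<open>t = 0\<close> excludes the indices up to \<open>l\<close>.\<close>

lemma w_eq_2:
  assumes "1 \<le> n" "\<And>t i. 1 \<le> i \<Longrightarrow> i \<le> l \<Longrightarrow> n \<noteq> (f ^^ t) i"
  shows "w n = 2"
  using assms
proof (induction n rule: less_induct)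
  case (less n)
  have "n \<ge> l + 1" using less.prems(2)[of n 0] less.prems(1) by force
  then obtain i j where ij: "i \<ge> 1" "j \<le> 2 * k" "n = f i + j" by (rule index_cases)
  show ?case
  proof (cases "j = 0")
    case True
    have "i < n" using f_ge[OF ij(1)] ij(3) l by simp
    moreover have "i \<noteq> (f ^^ t) i'" if "1 \<le> i'" "i' \<le> l" for t i'
      using less.prems(2)[OF that, of "Suc t"] ij True by auto
    ultimately have "w i = 2" using less.IH[of i] ij(1) by blast
    then show ?thesis using w_f[OF ij(1)] ij(3) True two_r by simp
  qed (use w_f_plus ij in auto)
qed

lemma m_g: "1 \<le> n \<Longrightarrow> m (g n) = m n ^ r * (- a) powi (- int k)"
proof -
  assume n: "1 \<le> n"
  have "(- a) * (- a) ^ (k - 1) = (- a) ^ k" using k by (cases k) auto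
  then have "(- a) ^ k = - (a * (- a) ^ (k - 1))" by simp
  then show ?thesis
    unfolding m_def[of "g n"] z_g[OF n] power_int_minus power_int_of_nat
    using nonzero char(5) by (simp add: field_simps)
qed

text \<open>By \<open>m_g\<close> the exponent of \<open>- a\<close> obeys
  \<open>E' = r * E - k\<close> with initial value \<open>- (k - 1)\<close>; the stated quotient is
  its solution, and the division is exact since its numerator is even.\<close>

lemma m_g_iter:
  assumes "1 \<le> i"
  shows "m ((g ^^ t) i) =
    1 / 2 * (- a) powi ((int (r ^ t) * (2 - int r) + 1) div 2) * z i ^ (r ^ t)"
proof (induction t)
  case 0
  have "(int (r ^ 0) * (2 - int r) + 1) div 2 = - int (k - 1)"
    using char(4) k by simp
  then show ?case
    by (simp only: power_int_minus power_int_of_nat) (simp add: m_def field_simps)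
next
  case (Suc t)
  define E where "E = (int (r ^ t) * (2 - int r) + 1) div 2"
  have "odd (int (r ^ t) * (2 - int r))" using odd_r by simp
  then have E: "int (r ^ t) * (2 - int r) = 2 * E - 1"
    using odd_succ_half[of "int (r ^ t) * (2 - int r)"] unfolding E_def by linarith
  have "int (r ^ Suc t) * (2 - int r) + 1 = int r * (int (r ^ t) * (2 - int r)) + 1"
    by simp
  also have "\<dots> = 2 * (int r * E - int k)"
    unfolding E using char(4) by (simp add: algebra_simps)
  finally have E': "(int (r ^ Suc t) * (2 - int r) + 1) div 2 = int r * E - int k"
    by simp
  have "m ((g ^^ Suc t) i) = m ((g ^^ t) i) ^ r * (- a) powi (- int k)"
    using m_g[OF g_iter_ge_1[OF assms]] by simp
  also have "\<dots> = (1 / 2) ^ r * ((- a) powi E) ^ r * (z i ^ (r ^ t)) ^ r * (- a) powi (- int k)"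
    unfolding Suc.IH E_def[symmetric] power_mult_distrib ..
  also have "(1 / 2 :: 'a) ^ r = 1 / 2" by (simp add: power_divide two_r)
  also have "((- a) powi E) ^ r = (- a) powi (int r * E)"
    by (metis power_int_mult power_int_of_nat mult.commute)
  also have "(z i ^ (r ^ t)) ^ r = z i ^ (r ^ Suc t)"
    by (simp add: power_mult[symmetric] mult.commute)
  finally show ?case
    unfolding E' using nonzero power_int_add[of "- a" "int r * E" "- int k"] by simp
qed

lemma z_eq_0:
  assumes "1 \<le> n" "\<And>t i. i \<in> I_star r l mu \<nu> \<Longrightarrow> n \<noteq> (g ^^ t) i"
  shows "z n = 0"
  using assms
proof (induction n rule: less_induct)
  case (less n)
  show ?case
  proof (cases "n \<le> l")
    case True
    then show ?thesis
      using less.prems(2)[of n 0] less.prems(1) by (auto simp: I_star_def z_def)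
  next
    case False
    then have "n \<ge> l + 1" by simp
    then obtain i j where ij: "i \<ge> 1" "j \<le> 2 * k" "n = f i + j" by (rule index_cases)
    show ?thesis
    proof (cases "j = k")
      case True
      have n: "n = g i" using ij True g_eq by simp
      have "i < n" using f_ge[OF ij(1)] ij(3) l by simp
      moreover have "i \<noteq> (g ^^ t) i'" if "i' \<in> I_star r l mu \<nu>" for t i'
        using less.prems(2)[OF that, of "Suc t"] n by auto
      ultimately have "z i = 0" using less.IH[of i] ij(1) by blast
      then show ?thesis unfolding n z_g[OF ij(1)] by (simp add: m_def zero_r)
    qed (use z_f_plus ij in auto)
  qed
qed

lemma mu_lam_g:
  assumes "1 \<le> n"
  shows "mu (g n) * inverse (lam (g n)) = m n"
    and "mu (g n + 1) * inverse (lam (g n + 1)) = - m n"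
proof -
  have "mu (g n) = lam (g n) * m n"
    using block(7)[OF assms regular[OF assms], of k] k by (simp add: g_eq[OF assms])
  moreover have "mu (g n + 1) = - (lam (g n + 1) * m n)"
    using block(7)[OF assms regular[OF assms], of "k + 1"] k by (simp add: g_eq[OF assms])
  ultimately show "mu (g n) * inverse (lam (g n)) = m n"
    "mu (g n + 1) * inverse (lam (g n + 1)) = - m n"
    using nondegenerate[of "g n"] nondegenerate[of "g n + 1"] g_ge_1[OF assms] by simp_all
qed

text \<open>Only positions \<open>k\<close> and \<open>k + 1\<close> of a block can carry a constant
  term, a multiple of \<open>m i\<close>; this vanishes unless \<open>i\<close> is an iterate under
  \<open>g\<close> of an element of \<open>I_star\<close>.\<close>

lemma mu_eq_0:
  assumes "n \<ge> l + 1" "n \<notin> G_set r l mu \<nu> \<union> Suc ` G_set r l mu \<nu>"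
  shows "mu n = 0"
proof -
  obtain i j where ij: "i \<ge> 1" "j \<le> 2 * k" "n = f i + j"
    using assms(1) by (rule index_cases)
  note reg = regular[OF ij(1)]
  have m0: "m i = 0" if "j = k \<or> j = k + 1"
  proof -
    have "i \<noteq> (g ^^ t) i'" if i': "i' \<in> I_star r l mu \<nu>" for t i'
    proof
      assume "i = (g ^^ t) i'"
      then have "g i \<in> G_set r l mu \<nu>" using G_setI[OF i'] by simp
      moreover have "n = g i \<or> n = Suc (g i)" using \<open>j = k \<or> j = k + 1\<close> g_eq[OF ij(1)] ij(3) by auto
      ultimately show False using assms(2) by blast
    qed
    then show ?thesis using z_eq_0[OF ij(1)] by (simp add: m_def)
  qed
  show ?thesis
  proof (cases "j = 0")
    case True
    then show ?thesis using block(3)[OF ij(1) reg] ij by simp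
  next
    case False
    then show ?thesis using block(7)[OF ij(1) reg, of j] m0 ij by auto
  qed
qed

lemma lam_product_f:
  assumes "1 \<le> n" "f n > l + 1"
  shows "lam (f n) * lam (f n - 1) = 2 / a / (1 - 1 / w n)"
proof -
  have "n \<noteq> 1" using assms f_1 by auto
  then obtain n' where n': "n = n' + 1" "n' \<ge> 1" using assms(1) by (intro that[of "n - 1"]) auto
  then have "f n - 1 = f n' + 2 * k" using f_Suc[of n'] by simp
  then show ?thesis using lam_product_0[of n'] regular n' by simp
qed

text \<open>The products themselves serve as \<open>C\<close>. Each clause becomes an identity for
  one product, and clauses that meet at the same index agree automatically.\<close>

lemma is_C_product: "is_C r l a lam mu \<delta> \<nu> (\<lambda>n. lam n * lam (n - 1))"
  unfolding is_C_def
proof (intro allI impI conjI ballI)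
  fix n assume n: "l + 1 < n"
  {
    assume out: "n \<notin> F_set r l \<union> Suc ` F_set r l \<union> Suc ` G_set r l mu \<nu>"
    \<comment> \<open>The generic value arises from \<open>w = 2\<close> both as
      \<open>2 / a * w\<close> and as \<open>2 / a / (1 - 1 / w)\<close>.\<close>
    have four: "4 * inverse a = 2 / a * 2" using nonzero by (simp add: field_simps)
    have half: "1 - 1 / 2 = (1 / 2 :: 'a)" using char(5) by (simp add: field_simps)
    have "n \<ge> l + 1" using n by simp
    then obtain i j where ij: "i \<ge> 1" "j \<le> 2 * k" "n = f i + j" by (rule index_cases)
    have w2: "w i = 2" if "f i \<notin> F_set r l"
    proof (rule w_eq_2[OF ij(1)])
      fix t i' assume "1 \<le> i'" "i' \<le> l"
      then show "i \<noteq> (f ^^ t) i'"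
        using that F_setI[of i' t] by auto
    qed
    consider "j = 0" | "j = 1" | "j = k + 1" | "j \<ge> 2" "j \<noteq> k + 1" by linarith
    then show "lam n * lam (n - 1) = 4 * inverse a"
    proof cases
      case 1
      then have "w i = 2" using w2 out ij by simp
      then show ?thesis
        using lam_product_f[OF ij(1)] n 1 ij(3) half four by simp
    next
      case 2
      then have "w i = 2" using w2 out ij by auto
      then show ?thesis
        using lam_product_1[OF ij(1) regular[OF ij(1)]] 2 ij(3) four by simp
    next
      case 3
      have "i \<noteq> (g ^^ t) i'" if i': "i' \<in> I_star r l mu \<nu>" for t i'
      proof
        assume "i = (g ^^ t) i'"
        then have "g i \<in> G_set r l mu \<nu>" using G_setI[OF i'] by simp
        moreover have "n = Suc (g i)" using 3 g_eq[OF ij(1)] ij(3) by auto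
        ultimately show False using out by blast
      qed
      then have "m i = 0" using z_eq_0[OF ij(1)] by (simp add: m_def)
      then show ?thesis
        using lam_product_2(1)[OF ij(1) regular[OF ij(1)], of k] k 3 ij(3) by (simp add: field_simps)
    next
      case 4
      then show ?thesis
        using lam_product_2(1)[OF ij(1) regular[OF ij(1)], of "j - 1"] ij(2,3) by (simp add: field_simps)
    qed
  }
  fix t assume t: "(1::nat) \<le> t"
  define R where "R = r ^ (t - 1)"
  {
    fix i assume i: "i \<in> {1..l}" and ni: "n = (f ^^ t) i"
    define N where "N = (f ^^ (t - 1)) i"
    have N: "1 \<le> N" "n = f N"
      using f_iter_ge_1[of i "t - 1"] i funpow_pred[OF t, of f i] by (simp_all add: N_def ni)
    have "lam n * lam (n - 1) = 2 / a / (1 - 1 / w N)"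
      using lam_product_f[OF N(1)] n unfolding N(2) by simp
    also have "w N = w i ^ R" using w_f_iter[of i "t - 1"] i by (simp add: N_def R_def)
    also have "1 - 1 / w i ^ R = (1 - inverse a * lam i powi (- int r) * \<delta> i) ^ R"
    proof -
      have "1 / w i = inverse a * lam i powi (- int r) * \<delta> i"
        by (simp add: w_def power_int_minus field_simps)
      then show ?thesis
        unfolding R_def r_pow_diff by (simp add: power_one_over[symmetric])
    qed
    finally show "lam n * lam (n - 1) = 2 * inverse a *
        (1 - inverse a * lam i powi (- int r) * \<delta> i) powi (- int (r ^ (t - 1)))"
      unfolding R_def power_int_minus power_int_of_nat by (simp add: divide_inverse)
  }
  {
    fix i assume i: "i \<in> {1..l}" and ni: "n = (f ^^ t) i + 1"
    define N where "N = (f ^^ (t - 1)) i"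
    have N: "1 \<le> N" "n = f N + 1"
      using f_iter_ge_1[of i "t - 1"] i funpow_pred[OF t, of f i] by (simp_all add: N_def ni)
    have "lam n * lam (n - 1) = 2 / a * w N"
      using lam_product_1[OF N(1) regular[OF N(1)]] unfolding N(2) by simp
    also have "w N = w i ^ R" using w_f_iter[of i "t - 1"] i by (simp add: N_def R_def)
    finally show "lam n * lam (n - 1) = 2 * inverse a * (a * lam i ^ r * inverse (\<delta> i)) ^ (r ^ (t - 1))"
      by (simp add: R_def w_def divide_inverse)
  }
  {
    fix i assume i: "i \<in> I_star r l mu \<nu>" and ni: "n = (g ^^ t) i + 1"
    have i1: "1 \<le> i" using i by (simp add: I_star_def)
    define N where "N = (g ^^ (t - 1)) i"
    have N: "1 \<le> N" "n = g N + 1"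
      using g_iter_ge_1[of i "t - 1"] i1 funpow_pred[OF t, of g i] by (simp_all add: N_def ni)
    define y where "y = a powi (2 - int r) * (\<nu> i - mu i ^ r)\<^sup>2 * \<delta> i powi (- 2)"
    have y: "y = a powi (2 - int r) * (z i)\<^sup>2"
      by (simp add: y_def z_def power_int_minus power_mult_distrib power_inverse divide_inverse)
    define E where "E = (int R * (2 - int r) + 1) div 2"
    have "odd (int R * (2 - int r))" using odd_r by (simp add: R_def)
    then have E: "E * 2 = int R * (2 - int r) + 1"
      unfolding E_def by (rule odd_succ_half)
    have "(m N)\<^sup>2 = 1 / 4 * ((- a) powi E)\<^sup>2 * (z i ^ R)\<^sup>2"
      unfolding N_def m_g_iter[OF i1] R_def[symmetric] E_def[symmetric]
      by (simp add: power_mult_distrib power_divide)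
    \<comment> \<open>Squaring removes the sign; the \<open>+ 1\<close> in \<open>E * 2\<close> then
      supplies the factor \<open>a\<close> that can be taken out of
      \<open>a / 4 + (m N)\<^sup>2\<close>.\<close>
    also have "((- a) powi E)\<^sup>2 = a powi (E * 2)"
    proof -
      have "((- a) powi E)\<^sup>2 = (- a) powi (2 * E)"
        by (metis power_int_mult power_int_numeral mult.commute)
      also have "\<dots> = a powi (2 * E)"
        by (simp add: power_int_mult)
      finally show ?thesis by (simp add: mult.commute)
    qed
    also have "a powi (E * 2) = (a powi (2 - int r)) ^ R * a"
      unfolding E using nonzero
      by (simp add: power_int_add power_int_mult mult.commute[of "int R"])
    finally have "a / 4 + (m N)\<^sup>2 = a / 4 * (1 + y ^ R)"
      by (simp add: y power_mult_distrib algebra_simps power_mult[symmetric])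
    also have "1 + y ^ R = (1 + y) ^ R" by (simp add: R_def r_pow_add)
    finally have middle: "a / 4 + (m N)\<^sup>2 = a / 4 * (1 + y) ^ R" .
    have "lam n * lam (n - 1) = 1 / (a / 4 + (m N)\<^sup>2)"
      using lam_product_2(1)[OF N(1) regular[OF N(1)], of k] k unfolding N(2) g_eq[OF N(1)] by simp
    then have "lam n * lam (n - 1) = 1 / (a / 4 * (1 + y) ^ R)"
      unfolding middle .
    then show "lam n * lam (n - 1) = 4 * inverse a *
      (1 + a powi (2 - int r) * (\<nu> i - mu i ^ r)\<^sup>2 * \<delta> i powi (- 2)) powi (- int (r ^ (t - 1)))"
      unfolding y_def[symmetric] R_def[symmetric] unfolding power_int_minus power_int_of_nat
      by (simp add: inverse_eq_divide)
  }
qed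

end

theorem mainTheorem1:
  fixes p s t q r l :: nat
    and a \<epsilon>1 \<epsilon>2 :: "'a::{field,finite}"
    and \<alpha> :: "'a fls"
    and A :: "nat \<Rightarrow> 'a poly"
    and lam mu \<delta> \<nu> :: "nat \<Rightarrow> 'a"
  assumes "prime p" and "odd p" and "s \<ge> 1" and "t \<ge> 1" and "l \<ge> 1"
    and "q = p ^ s" and "r = p ^ t"
    and "CARD('a) = q"
    and "a \<noteq> 0" and "\<epsilon>1 \<noteq> 0" and "\<epsilon>2 \<noteq> 0"
    and cfrac: "has_cfrac \<alpha> A"
    and lam_def: "\<And>n. n \<ge> 1 \<Longrightarrow> lam n = coeff (A n) 1"
    and mu_def: "\<And>n. n \<ge> 1 \<Longrightarrow> mu n = coeff (A n) 0"
    and init: "\<And>i. 1 \<le> i \<Longrightarrow> i \<le> l \<Longrightarrow> lam i \<noteq> 0 \<and> A i = [:mu i, lam i:]"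
    and equation: "\<alpha> ^ r =
      fls_const \<epsilon>1 * poly_to_fls (P_poly r a) * complete_quotient A (l + 1)
      + fls_const \<epsilon>2 * poly_to_fls (Q_poly r a)"
    and \<delta>_nonzero: "\<And>i. 1 \<le> i \<Longrightarrow> i \<le> l \<Longrightarrow> \<delta> i \<noteq> 0"
    and denom_nonzero: "\<And>i. 1 \<le> i \<Longrightarrow> i \<le> l - 1 \<Longrightarrow>
      a ^ (r - 2) * (\<delta> i)\<^sup>2 + (\<nu> i - mu i ^ r)\<^sup>2 \<noteq> 0"
    and C1_init: "\<delta> 1 = a * lam 1 ^ r + \<epsilon>2" "\<nu> 1 = 0"
    and C1_\<delta>: "\<And>i. 1 \<le> i \<Longrightarrow> i \<le> l - 1 \<Longrightarrow>
      \<delta> (i + 1) = a * lam (i + 1) ^ r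
        - \<delta> i / (a ^ (r - 2) * (\<delta> i)\<^sup>2 + (\<nu> i - mu i ^ r)\<^sup>2)"
    and C1_\<nu>: "\<And>i. 1 \<le> i \<Longrightarrow> i \<le> l - 1 \<Longrightarrow>
      \<nu> (i + 1) = (\<nu> i - mu i ^ r) / (a ^ (r - 2) * (\<delta> i)\<^sup>2 + (\<nu> i - mu i ^ r)\<^sup>2)"
    and C2: "\<delta> l = - a * (\<epsilon>1 / \<epsilon>2) ^ r"
    and C3: "mu l ^ r = \<nu> l"
  shows "(\<forall>n\<ge>1. degree (A n) = 1) \<and> \<alpha> \<in> E_star r l a \<and>
    (\<forall>n\<ge>1. lam n \<noteq> 0 \<and> A n = [:mu n, lam n:]) \<and>
    lam (l + 1) = lam 1 ^ r * inverse \<epsilon>1 \<and>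
    (\<exists>C. is_C r l a lam mu \<delta> \<nu> C \<and>
         (\<forall>n>l + 1. lam n = C n * inverse (lam (n - 1)))) \<and>
    (\<forall>n\<ge>l + 1. n \<notin> G_set r l mu \<nu> \<union> Suc ` G_set r l mu \<nu> \<longrightarrow> mu n = 0) \<and>
    (\<forall>m\<ge>1. \<forall>i\<in>I_star r l mu \<nu>. \<forall>n. n = (g_map r l ^^ m) i \<longrightarrow>
       mu n * inverse (lam n) = - (mu (n + 1) * inverse (lam (n + 1))) \<and>
       mu n * inverse (lam n) =
         1 / 2 * (- a) powi ((int (r ^ (m - 1)) * (2 - int r) + 1) div 2)
           * ((\<nu> i - mu i ^ r) * inverse (\<delta> i)) ^ (r ^ (m - 1)))"
proof -
  define k where "k = (r - 1) div 2"
  have p3: "p \<ge> 3" using \<open>prime p\<close> \<open>odd p\<close> prime_ge_2_nat[of p] by (cases "p = 2") auto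
  have r_odd: "odd r" using \<open>odd p\<close> \<open>r = p ^ t\<close> by simp
  have "p ^ 1 \<le> p ^ t" using p3 \<open>t \<ge> 1\<close> by (intro power_increasing) auto
  then have r3: "r \<ge> 3" using p3 \<open>r = p ^ t\<close> by simp
  have rk: "r = 2 * k + 1" "k \<ge> 1" using r_odd r3 by (auto simp: k_def elim!: oddE)
  have char: "CHAR('a) = p"
    using CHAR_eq_of_CARD[of p s] \<open>prime p\<close> \<open>CARD('a) = q\<close> \<open>q = p ^ s\<close> by simp
  have two: "(2::'a) \<noteq> 0"
  proof
    assume "(2::'a) = 0"
    then have "CHAR('a) dvd 2" using of_nat_eq_0_iff_char_dvd[of 2, where 'a = 'a] by simp
    then show False using char p3 by (auto dest: dvd_imp_le)
  qed
  \<comment> \<open>The hypotheses describe \<delta> and \<nu> up to \<open>l\<close> only, while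
    the locale runs the recursion over all indices; division being total, it can simply be
    continued. \<open>S n\<close> holds the pair of index \<open>n + 1\<close>.\<close>
  define adv where "adv = (\<lambda>n (d, v). let D = a ^ (r - 2) * d\<^sup>2 + (v - mu (n + 1) ^ r)\<^sup>2
    in (a * lam (n + 2) ^ r - d / D, (v - mu (n + 1) ^ r) / D))"
  define S where "S = rec_nat (\<delta> 1, \<nu> 1) adv"
  define \<delta>' \<nu>' where "\<delta>' i = fst (S (i - 1))" and "\<nu>' i = snd (S (i - 1))" for i
  have rec: "\<delta>' (i + 1) = a * lam (i + 1) ^ r - \<delta>' i / (a ^ (r - 2) * (\<delta>' i)\<^sup>2 + (\<nu>' i - mu i ^ r)\<^sup>2)"
    "\<nu>' (i + 1) = (\<nu>' i - mu i ^ r) / (a ^ (r - 2) * (\<delta>' i)\<^sup>2 + (\<nu>' i - mu i ^ r)\<^sup>2)"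
    if "1 \<le> i" for i
    using that by (cases i; simp add: \<delta>'_def \<nu>'_def S_def adv_def Let_def case_prod_beta)+
  have agree: "\<delta>' i = \<delta> i \<and> \<nu>' i = \<nu> i" if "1 \<le> i" "i \<le> l" for i
    using that
  proof (induction i rule: dec_induct)
    case base
    show ?case by (simp add: \<delta>'_def \<nu>'_def S_def)
  next
    case (step i)
    then have IH: "\<delta>' i = \<delta> i" "\<nu>' i = \<nu> i" "1 \<le> i" "i \<le> l - 1" by auto
    show ?case
      using rec[OF IH(3)] C1_\<delta>[OF IH(3,4)] C1_\<nu>[OF IH(3,4)] unfolding IH(1,2) by simp
  qed
  interpret hyperquadratic_cfrac p t r k l a \<epsilon>1 \<epsilon>2 \<alpha> A lam mu \<delta>' \<nu>'
  proof
    show "1 \<le> l" by fact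
  qed (use assms char two rk agree rec in auto)
  \<comment> \<open>\<open>I_star\<close> and \<open>is_C\<close> read \<delta> and \<nu> at indices
    up to \<open>l\<close> only, where the continued sequences agree with the given ones.\<close>
  have I: "I_star r l mu \<nu>' = I_star r l mu \<nu>"
    using agree by (auto simp: I_star_def)
  then have G: "G_set r l mu \<nu>' = G_set r l mu \<nu>" by (simp add: G_set_def)
  have reg: "lam n \<noteq> 0 \<and> A n = [:mu n, lam n:]" if "n \<ge> 1" for n
    using nondegenerate[OF that] by simp
  have deg: "\<forall>n\<ge>1. degree (A n) = 1"
  proof (intro allI impI)
    fix n :: nat assume "n \<ge> 1"
    from reg[OF this] show "degree (A n) = 1" by simp
  qed
  have "\<alpha> \<in> E_set r l a"
    unfolding E_set_def
    by (rule CollectI, intro exI[of _ A] exI[of _ lam] exI[of _ mu] exI[of _ \<epsilon>1] exI[of _ \<epsilon>2])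
       (use assms in auto)
  then have E: "\<alpha> \<in> E_star r l a" unfolding E_star_def using cfrac deg by auto
  have lam_Suc_l: "lam (l + 1) = lam 1 ^ r * inverse \<epsilon>1"
    using block(2)[of 1] regular_1 f_1 by (simp add: eps_def divide_inverse)
  have C: "is_C r l a lam mu \<delta> \<nu> (\<lambda>n. lam n * lam (n - 1))"
    using is_C_product agree unfolding is_C_def I G by (auto simp: I_star_def)
  have C': "\<forall>n>l + 1. lam n = lam n * lam (n - 1) * inverse (lam (n - 1))"
  proof (intro allI impI)
    fix n assume "l + 1 < n"
    then have "lam (n - 1) \<noteq> 0" using reg[of "n - 1"] by simp
    then show "lam n = lam n * lam (n - 1) * inverse (lam (n - 1))" by simp
  qed
  have mu0: "\<forall>n\<ge>l + 1. n \<notin> G_set r l mu \<nu> \<union> Suc ` G_set r l mu \<nu> \<longrightarrow> mu n = 0"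
    using mu_eq_0 unfolding G by blast
  have muG: "mu n * inverse (lam n) = - (mu (n + 1) * inverse (lam (n + 1))) \<and>
      mu n * inverse (lam n) =
         1 / 2 * (- a) powi ((int (r ^ (m - 1)) * (2 - int r) + 1) div 2)
           * ((\<nu> i - mu i ^ r) * inverse (\<delta> i)) ^ (r ^ (m - 1))"
    if m: "m \<ge> 1" and i: "i \<in> I_star r l mu \<nu>" and n: "n = (g_map r l ^^ m) i" for m i n
  proof -
    have i1: "1 \<le> i" "i \<le> l" using i by (auto simp: I_star_def)
    define N where "N = (g_map r l ^^ (m - 1)) i"
    have N: "1 \<le> N" "n = g_map r l N"
      using g_iter_ge_1[OF i1(1)] funpow_pred[OF m] by (simp_all add: N_def n)
    have "z i = (\<nu> i - mu i ^ r) * inverse (\<delta> i)"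
      using agree[OF i1] by (simp add: z_def divide_inverse)
    then show ?thesis
      using mu_lam_g[OF N(1)] m_g_iter[OF i1(1), of "m - 1"] unfolding N_def[symmetric] N(2) by simp
  qed
  show ?thesis
    using deg E reg lam_Suc_l C C' mu0 muG by blast
qed

end
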